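(* If $R$ is a right (respectively, left) perfect ring and $G$ is a locally finite group, then the group ring $RG$ is strongly unit nil-clean.
   Context: Rings are associative with identity, not necessarily commutative. An element of a ring is strongly nil-clean if it is the sum of an idempotent $e$ and a nilpotent $b$ with $eb=be$. A ring $S$ is strongly unit nil-clean if for every $a\in S$ there is a unit $u\in S$ such that $ua$ is strongly nil-clean. A ring $R$ is right (left) perfect if $R/J(R)$ is semisimple and the Jacobson radical $J(R)$ is right (left) T-nilpotent. A group is locally finite if each of its finitely generated subgroups is finite. *)

theory Defs
  imports "HOL-Algebra.Algebra"
begin

text \<open>
  Throughout, \<^locale>\<open>ring\<close> is the HOL-Algebra locale: associative, with identity, not necessarily
  commutative; the zero ring is allowed.
\<close>

section \<open>Perfect rings\<close>

locale left_ideal = additive_subgroup I R + ring R for I and R (structure) +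
  assumes I_l_closed: "\<lbrakk>a \<in> I; x \<in> carrier R\<rbrakk> \<Longrightarrow> x \<otimes> a \<in> I"

definition maximal_left_ideal :: "'a set \<Rightarrow> ('a, 'm) ring_scheme \<Rightarrow> bool" where
  "maximal_left_ideal M R \<longleftrightarrow>
     left_ideal M R \<and> M \<noteq> carrier R \<and>
     (\<forall>N. left_ideal N R \<and> M \<subseteq> N \<longrightarrow> N = M \<or> N = carrier R)"

text \<open>
  Using left rather than right ideals is immaterial, both in the Jacobson radical and in
  semisimplicity. The radical is cut out of the carrier so that it is the whole ring when there is
  no maximal left ideal (the zero ring).
\<close>

definition jacobson_radical :: "('a, 'm) ring_scheme \<Rightarrow> 'a set" where
  "jacobson_radical R = {x \<in> carrier R. \<forall>M. maximal_left_ideal M R \<longrightarrow> x \<in> M}"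

text \<open>A ring is semisimple if its regular left module is: every submodule is a direct summand.\<close>

definition semisimple_ring :: "('a, 'm) ring_scheme \<Rightarrow> bool" where
  "semisimple_ring R \<longleftrightarrow>
     ring R \<and>
     (\<forall>I. left_ideal I R \<longrightarrow>
        (\<exists>K. left_ideal K R \<and> I \<inter> K = {\<zero>\<^bsub>R\<^esub>} \<and> I <+>\<^bsub>R\<^esub> K = carrier R))"

text \<open>
  \<open>prod_lr R a n\<close> is \<open>a 0 \<otimes> a 1 \<otimes> \<dots> \<otimes> a (n - 1)\<close> and
  \<open>prod_rl R a n\<close> is \<open>a (n - 1) \<otimes> \<dots> \<otimes> a 1 \<otimes> a 0\<close>.
\<close>

primrec prod_lr :: "('a, 'm) monoid_scheme \<Rightarrow> (nat \<Rightarrow> 'a) \<Rightarrow> nat \<Rightarrow> 'a" where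
  "prod_lr R a 0 = \<one>\<^bsub>R\<^esub>"
| "prod_lr R a (Suc n) = prod_lr R a n \<otimes>\<^bsub>R\<^esub> a n"

primrec prod_rl :: "('a, 'm) monoid_scheme \<Rightarrow> (nat \<Rightarrow> 'a) \<Rightarrow> nat \<Rightarrow> 'a" where
  "prod_rl R a 0 = \<one>\<^bsub>R\<^esub>"
| "prod_rl R a (Suc n) = a n \<otimes>\<^bsub>R\<^esub> prod_rl R a n"

definition left_T_nilpotent :: "('a, 'm) ring_scheme \<Rightarrow> 'a set \<Rightarrow> bool" where
  "left_T_nilpotent R A \<longleftrightarrow> (\<forall>a. range a \<subseteq> A \<longrightarrow> (\<exists>n\<ge>1. prod_lr R a n = \<zero>\<^bsub>R\<^esub>))"

definition right_T_nilpotent :: "('a, 'm) ring_scheme \<Rightarrow> 'a set \<Rightarrow> bool" where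
  "right_T_nilpotent R A \<longleftrightarrow> (\<forall>a. range a \<subseteq> A \<longrightarrow> (\<exists>n\<ge>1. prod_rl R a n = \<zero>\<^bsub>R\<^esub>))"

definition left_perfect_ring :: "('a, 'm) ring_scheme \<Rightarrow> bool" where
  "left_perfect_ring R \<longleftrightarrow>
     ring R \<and> semisimple_ring (R Quot jacobson_radical R) \<and>
     left_T_nilpotent R (jacobson_radical R)"

definition right_perfect_ring :: "('a, 'm) ring_scheme \<Rightarrow> bool" where
  "right_perfect_ring R \<longleftrightarrow>
     ring R \<and> semisimple_ring (R Quot jacobson_radical R) \<and>
     right_T_nilpotent R (jacobson_radical R)"

section \<open>Locally finite groups and group rings\<close>

definition locally_finite_group :: "('g, 'm) monoid_scheme \<Rightarrow> bool" where
  "locally_finite_group G \<longleftrightarrow>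
     group G \<and> (\<forall>S. finite S \<and> S \<subseteq> carrier G \<longrightarrow> finite (generate G S))"

text \<open>
  An element of \<open>RG\<close> is its coefficient function, of finite support. It is set to zero
  outside the carrier of \<open>G\<close>, so that equality of elements is equality of HOL functions.
\<close>

definition group_ring :: "('r, 'n) ring_scheme \<Rightarrow> ('g, 'm) monoid_scheme \<Rightarrow> ('g \<Rightarrow> 'r) ring" where
  "group_ring R G =
     \<lparr>carrier = {f. (\<forall>g \<in> carrier G. f g \<in> carrier R) \<and>
                    (\<forall>g. g \<notin> carrier G \<longrightarrow> f g = \<zero>\<^bsub>R\<^esub>) \<and>
                    finite {g. f g \<noteq> \<zero>\<^bsub>R\<^esub>}},
      monoid.mult = (\<lambda>f h g.
                \<Oplus>\<^bsub>R\<^esub>p \<in> {(x, y). f x \<noteq> \<zero>\<^bsub>R\<^esub> \<and> h y \<noteq> \<zero>\<^bsub>R\<^esub> \<and> x \<otimes>\<^bsub>G\<^esub> y = g}.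
                  f (fst p) \<otimes>\<^bsub>R\<^esub> h (snd p)),
      one = (\<lambda>g. if g = \<one>\<^bsub>G\<^esub> then \<one>\<^bsub>R\<^esub> else \<zero>\<^bsub>R\<^esub>),
      ring.zero = (\<lambda>g. \<zero>\<^bsub>R\<^esub>),
      add = (\<lambda>f h g. f g \<oplus>\<^bsub>R\<^esub> h g)\<rparr>"

section \<open>Strongly unit nil-clean rings\<close>

definition strongly_nil_clean_elem :: "('a, 'm) ring_scheme \<Rightarrow> 'a \<Rightarrow> bool" where
  "strongly_nil_clean_elem S x \<longleftrightarrow>
     (\<exists>e \<in> carrier S. \<exists>b \<in> carrier S.
        e \<otimes>\<^bsub>S\<^esub> e = e \<and> (\<exists>n::nat. b [^]\<^bsub>S\<^esub> n = \<zero>\<^bsub>S\<^esub>) \<and>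
        e \<otimes>\<^bsub>S\<^esub> b = b \<otimes>\<^bsub>S\<^esub> e \<and> x = e \<oplus>\<^bsub>S\<^esub> b)"

definition strongly_unit_nil_clean_ring :: "('a, 'm) ring_scheme \<Rightarrow> bool" where
  "strongly_unit_nil_clean_ring S \<longleftrightarrow>
     ring S \<and>
     (\<forall>a \<in> carrier S. \<exists>u \<in> Units S. strongly_nil_clean_elem S (u \<otimes>\<^bsub>S\<^esub> a))"

end

theory Submission
  imports Defs
begin

text \<open>
  Every element \<open>a\<close> of \<open>RG\<close> lies in \<open>RH\<close> for a finite subgroup \<open>H\<close>, and every element of \<open>RH\<close>
  is strongly \<open>\<pi>\<close>-regular. It then has a Drazin inverse \<open>b\<close>, so \<open>e = a b\<close> is idempotent, \<open>(1 - e) a\<close> is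
  nilpotent, and the unit \<open>u = b + (1 - e)\<close> satisfies \<open>u a = e + (1 - e) a\<close>.

  For the strong \<open>\<pi>\<close>-regularity of \<open>RH\<close>, let \<open>J\<close> be the radical of \<open>R\<close>. The ring \<open>(R/J)H\<close> is a left module
  of finite length over the semisimple ring \<open>R/J\<close>, and Fitting's lemma applies. The kernel \<open>JH\<close> of
  \<open>RH \<rightarrow> (R/J)H\<close> is T-nilpotent on the same side as \<open>J\<close>, and strong \<open>\<pi>\<close>-regularity lifts along a
  surjection with T-nilpotent kernel: if \<open>e\<close> lifts the Fitting idempotent of the image of \<open>a\<close>, the left
  ideals \<open>S e a\<^sup>k\<close> of \<open>S = RH\<close> have idempotent generators \<open>g\<^sub>k\<close> congruent to \<open>e\<close>, and
  \<open>g\<^sub>k\<^sub>+\<^sub>1 - g\<^sub>k\<close> is a multiple of a product of \<open>k\<close> factors \<open>a (1 - g\<^sub>j)\<close>, blocks of which lie in the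
  kernel. Hence the sequence becomes stationary, and \<open>a\<close> is block triangular with an invertible and
  a nilpotent diagonal block.
\<close>

section \<open>Strongly \<open>\<pi>\<close>-regular elements\<close>

text \<open>Together the two equations place \<open>a [^] n\<close> in a subgroup of the
  multiplicative semigroup of \<open>S\<close>. Asking for both sides makes the notion symmetric
  under passing to the opposite ring. The bound \<open>n \<ge> 1\<close> matters:
  \<open>n = 0\<close> would admit every element.\<close>

definition strongly_pi_regular_elem :: "('a, 'm) ring_scheme \<Rightarrow> 'a \<Rightarrow> bool" where
  "strongly_pi_regular_elem S a \<longleftrightarrow>
     (\<exists>n::nat. n \<ge> 1 \<and> (\<exists>y \<in> carrier S. \<exists>z \<in> carrier S.
        y \<otimes>\<^bsub>S\<^esub> (a [^]\<^bsub>S\<^esub> n \<otimes>\<^bsub>S\<^esub> a [^]\<^bsub>S\<^esub> n) = a [^]\<^bsub>S\<^esub> n \<and>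
        a [^]\<^bsub>S\<^esub> n \<otimes>\<^bsub>S\<^esub> a [^]\<^bsub>S\<^esub> n \<otimes>\<^bsub>S\<^esub> z = a [^]\<^bsub>S\<^esub> n))"

context ring
begin

section \<open>Powers of commuting elements and of idempotents\<close>

lemma pow_commute:
  assumes "a \<in> carrier R" "b \<in> carrier R" "a \<otimes> b = b \<otimes> a"
  shows "a [^] (n::nat) \<otimes> b = b \<otimes> a [^] n"
proof (induction n)
  case 0 then show ?case using assms by simp
next
  case (Suc n)
  have "a [^] Suc n \<otimes> b = a [^] n \<otimes> (b \<otimes> a)" using assms by (simp add: m_assoc)
  also have "\<dots> = b \<otimes> a [^] n \<otimes> a" using assms Suc by (simp add: m_assoc[symmetric])
  finally show ?case using assms by (simp add: m_assoc)
qed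

lemma commuting_pow_mult:
  assumes "a \<in> carrier R" "b \<in> carrier R" "a \<otimes> b = b \<otimes> a"
  shows "(a \<otimes> b) [^] (n::nat) = a [^] n \<otimes> b [^] n"
proof (induction n)
  case 0 then show ?case by simp
next
  case (Suc n)
  have "(a \<otimes> b) [^] Suc n = a [^] n \<otimes> (b [^] n \<otimes> a) \<otimes> b"
    using assms Suc by (simp add: m_assoc)
  also have "b [^] n \<otimes> a = a \<otimes> b [^] n" using assms pow_commute[of b a n] by simp
  finally show ?case using assms by (simp add: m_assoc)
qed

lemma idem_pow:
  assumes "e \<in> carrier R" "e \<otimes> e = e"
  shows "e [^] Suc n = e"
  by (induction n) (use assms in auto)

text \<open>The power \<open>\<alpha> = a [^] n\<close> lies in a multiplicative group with identity
  \<open>e\<close>. If \<open>w\<close> is its inverse there, then \<open>e\<close> and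
  \<open>w\<close> commute with \<open>a\<close>, and \<open>a [^] (n - 1) \<otimes> w\<close> is
  the Drazin inverse of \<open>a\<close>.\<close>

lemma strongly_pi_regular_elem_drazin:
  assumes a: "a \<in> carrier R" and "strongly_pi_regular_elem R a"
  obtains b n where "b \<in> carrier R" "(n::nat) \<ge> 1" "a \<otimes> b = b \<otimes> a" "b \<otimes> (a \<otimes> b) = b"
    "a [^] n \<otimes> (a \<otimes> b) = a [^] n"
proof -
  obtain n :: nat and y z where n: "n \<ge> 1" and y[simp]: "y \<in> carrier R" and z[simp]: "z \<in> carrier R"
    and yz: "y \<otimes> (a [^] n \<otimes> a [^] n) = a [^] n" "a [^] n \<otimes> a [^] n \<otimes> z = a [^] n"
    using assms unfolding strongly_pi_regular_elem_def by blast
  define \<alpha> where "\<alpha> = a [^] n"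
  define e where "e = y \<otimes> \<alpha>"
  define w where "w = y \<otimes> e"
  note [simp] = a
  have \<alpha>[simp]: "\<alpha> \<in> carrier R" and e[simp]: "e \<in> carrier R" and w[simp]: "w \<in> carrier R"
    by (auto simp: \<alpha>_def e_def w_def)
  have a\<alpha>: "a \<otimes> \<alpha> = \<alpha> \<otimes> a" unfolding \<alpha>_def by (rule pow_commute[symmetric]) auto
  \<comment> \<open>Left and right identity agree because both equal
    \<open>y \<otimes> (\<alpha> \<otimes> \<alpha>) \<otimes> z\<close>.\<close>
  have e2: "e = \<alpha> \<otimes> z"
  proof -
    have "e = y \<otimes> (\<alpha> \<otimes> \<alpha> \<otimes> z)" using yz by (simp add: e_def \<alpha>_def)
    also have "\<dots> = y \<otimes> (\<alpha> \<otimes> \<alpha>) \<otimes> z" by (simp add: m_assoc)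
    finally show ?thesis using yz by (simp add: \<alpha>_def)
  qed
  have e\<alpha>: "e \<otimes> \<alpha> = \<alpha>" using yz by (simp add: e_def \<alpha>_def m_assoc)
  have \<alpha>e: "\<alpha> \<otimes> e = \<alpha>" using yz by (simp add: e2 \<alpha>_def m_assoc)
  have ee: "e \<otimes> e = e" using \<alpha>e by (simp add: e_def m_assoc)
  have we: "w \<otimes> e = w" by (simp add: w_def m_assoc ee)
  have w2: "w = e \<otimes> z" by (simp add: w_def e2 m_assoc[symmetric]) (simp add: e_def e2[symmetric])
  have ew: "e \<otimes> w = w" by (simp add: w2 m_assoc[symmetric] ee)
  have w\<alpha>: "w \<otimes> \<alpha> = e" by (simp add: w_def m_assoc e\<alpha>) (simp add: e_def)
  have \<alpha>w: "\<alpha> \<otimes> w = e" by (simp add: w2 m_assoc[symmetric] \<alpha>e) (simp add: e2)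
  \<comment> \<open>Writing \<open>e\<close> as \<open>w \<otimes> \<alpha>\<close> or
    \<open>\<alpha> \<otimes> w\<close> and moving \<open>a\<close> past \<open>\<alpha>\<close>,
    the factor \<open>\<alpha>\<close> absorbs one more \<open>e\<close> on its outer side. So
    \<open>e a = e a e\<close> and \<open>a e = e a e\<close>, whence \<open>e\<close> commutes with
    \<open>a\<close>.\<close>
  have "e \<otimes> a = w \<otimes> (\<alpha> \<otimes> a) \<otimes> e"
  proof -
    have "e \<otimes> a = w \<otimes> (a \<otimes> \<alpha>)" by (simp add: w\<alpha>[symmetric] m_assoc a\<alpha>)
    also have "\<dots> = w \<otimes> (a \<otimes> \<alpha>) \<otimes> e" by (simp add: m_assoc \<alpha>e)
    finally show ?thesis by (simp add: a\<alpha>)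
  qed
  then have 1: "e \<otimes> a = e \<otimes> a \<otimes> e" by (simp add: w\<alpha> m_assoc[symmetric])
  have "a \<otimes> e = e \<otimes> (a \<otimes> \<alpha>) \<otimes> w"
  proof -
    have "a \<otimes> e = (\<alpha> \<otimes> a) \<otimes> w" by (simp add: \<alpha>w[symmetric] m_assoc[symmetric] a\<alpha>)
    also have "\<dots> = e \<otimes> (\<alpha> \<otimes> a) \<otimes> w" by (simp add: m_assoc[symmetric] e\<alpha>)
    finally show ?thesis by (simp add: a\<alpha>)
  qed
  then have 2: "a \<otimes> e = e \<otimes> a \<otimes> e" by (simp add: \<alpha>w m_assoc)
  have ae: "a \<otimes> e = e \<otimes> a" using 1 2 by simp
  have aw: "a \<otimes> w = w \<otimes> a"
  proof -
    have "a \<otimes> w = a \<otimes> e \<otimes> w" by (simp add: m_assoc ew)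
    also have "\<dots> = e \<otimes> a \<otimes> w" by (simp add: ae)
    also have "\<dots> = w \<otimes> (\<alpha> \<otimes> a) \<otimes> w" by (simp add: w\<alpha>[symmetric] m_assoc)
    also have "\<dots> = w \<otimes> (a \<otimes> e)" by (simp add: a\<alpha>[symmetric] m_assoc \<alpha>w)
    also have "\<dots> = w \<otimes> a" by (simp add: ae m_assoc[symmetric] we)
    finally show ?thesis .
  qed
  \<comment> \<open>Since \<open>n \<ge> 1\<close>, one factor \<open>a\<close> can be split off
    \<open>\<alpha>\<close>; multiplying \<open>b\<close> by \<open>a\<close> restores
    \<open>\<alpha>\<close> and gives \<open>e\<close> on both sides.\<close>
  define m where "m = n - 1"
  have nm: "n = Suc m" using n by (simp add: m_def)
  define b where "b = a [^] m \<otimes> w"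
  have b[simp]: "b \<in> carrier R" by (simp add: b_def)
  have "a \<otimes> b = a \<otimes> a [^] m \<otimes> w" by (simp add: b_def m_assoc)
  also have "a \<otimes> a [^] m = \<alpha>" by (simp add: \<alpha>_def nm pow_commute)
  finally have ab: "a \<otimes> b = e" by (simp add: \<alpha>w)
  have "b \<otimes> a = a [^] m \<otimes> a \<otimes> w" by (simp add: b_def m_assoc aw)
  then have ba: "b \<otimes> a = e" by (simp add: \<alpha>w flip: nat_pow_Suc nm \<alpha>_def)
  show ?thesis
    by (rule that[of b n]) (use n ab ba we \<alpha>e in \<open>auto simp: b_def m_assoc \<alpha>_def\<close>)
qed

lemma strongly_unit_nil_clean_of_strongly_pi_regular:
  assumes "\<And>a. a \<in> carrier R \<Longrightarrow> strongly_pi_regular_elem R a"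
  shows "strongly_unit_nil_clean_ring R"
  unfolding strongly_unit_nil_clean_ring_def
proof (intro conjI ballI)
  show "ring R" by (rule ring_axioms)
next
  fix a assume a[simp]: "a \<in> carrier R"
  obtain b n where b[simp]: "b \<in> carrier R" and n: "(n::nat) \<ge> 1" and ab: "a \<otimes> b = b \<otimes> a"
    and bab: "b \<otimes> (a \<otimes> b) = b" and an: "a [^] n \<otimes> (a \<otimes> b) = a [^] n"
    using strongly_pi_regular_elem_drazin[OF a assms[OF a]] by blast
  define e where "e = a \<otimes> b"
  define f where "f = \<one> \<ominus> e"
  have e[simp]: "e \<in> carrier R" and f[simp]: "f \<in> carrier R" by (auto simp: e_def f_def)
  have ee: "e \<otimes> e = e" unfolding e_def by (simp add: m_assoc bab)
  have ea: "e \<otimes> a = a \<otimes> e" unfolding e_def by (simp add: m_assoc ab[symmetric])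
  have be: "b \<otimes> e = b" using bab by (simp add: e_def)
  have eb: "e \<otimes> b = b" using bab by (simp add: e_def ab m_assoc)
  have ef: "e \<otimes> f = \<zero>" and fe: "f \<otimes> e = \<zero>"
    by (simp_all add: f_def minus_eq r_distr l_distr r_minus l_minus ee r_neg)
  have ff: "f \<otimes> f = f"
    using fe unfolding f_def by (simp add: minus_eq r_distr l_distr r_minus l_minus ee r_neg)
  have efs: "e \<oplus> f = \<one>" unfolding f_def using a_lcomm[of e \<one> "\<ominus> e"] by (simp add: minus_eq r_neg)
  have fa: "f \<otimes> a = a \<otimes> f"
    unfolding f_def by (simp add: minus_eq r_distr l_distr r_minus l_minus ea)
  have bf: "b \<otimes> f = \<zero>" and fb: "f \<otimes> b = \<zero>"
    unfolding f_def by (simp_all add: minus_eq r_distr l_distr r_minus l_minus be eb r_neg)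
  define u where "u = b \<oplus> f"
  \<comment> \<open>The inverse of \<open>u\<close>, block by block: \<open>a \<otimes> e\<close>
    inverts \<open>b\<close> in the corner of \<open>e\<close>, and \<open>f\<close> is the identity
    of the complementary corner.\<close>
  define u' where "u' = a \<otimes> e \<oplus> f"
  have bae: "b \<otimes> (a \<otimes> e) = e" by (simp add: m_assoc[symmetric] ab[symmetric]) (simp add: e_def[symmetric] ee)
  have aeb: "a \<otimes> e \<otimes> b = e" by (simp add: m_assoc eb) (simp add: e_def)
  have fae: "f \<otimes> (a \<otimes> e) = \<zero>" by (simp add: m_assoc[symmetric] fa) (simp add: m_assoc fe)
  have aef: "a \<otimes> e \<otimes> f = \<zero>" by (simp add: m_assoc ef)
  have "u \<otimes> u' = \<one>" unfolding u_def u'_def by (simp add: r_distr l_distr bae bf fae ff efs)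
  moreover have "u' \<otimes> u = \<one>" unfolding u_def u'_def by (simp add: r_distr l_distr aeb aef fb ff efs)
  moreover have "u \<in> carrier R" "u' \<in> carrier R" by (auto simp: u_def u'_def)
  ultimately have "u \<in> Units R" unfolding Units_def by blast
  moreover have "strongly_nil_clean_elem R (u \<otimes> a)"
    unfolding strongly_nil_clean_elem_def
  proof (intro bexI conjI exI)
    show "e \<otimes> e = e" by (rule ee)
    \<comment> \<open>The identity \<open>f [^] n = f\<close> requires a positive exponent.\<close>
    obtain m where nm: "n = Suc m" using n by (cases n) auto
    have "(f \<otimes> a) [^] n = f \<otimes> a [^] n"
      unfolding commuting_pow_mult[OF f a fa] by (simp only: nm idem_pow[OF f ff])
    also have "\<dots> = a [^] n \<otimes> f" using pow_commute[OF a f fa[symmetric]] by simp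
    also have "\<dots> = \<zero>"
      using an unfolding f_def by (simp add: minus_eq r_distr r_minus r_neg flip: e_def)
    finally show "(f \<otimes> a) [^] n = \<zero>" .
    show "e \<otimes> (f \<otimes> a) = f \<otimes> a \<otimes> e"
      by (simp add: m_assoc[symmetric] ef) (simp add: fa m_assoc fe)
    show "u \<otimes> a = e \<oplus> f \<otimes> a" unfolding u_def by (simp add: l_distr e_def ab)
  qed auto
  ultimately show "\<exists>u\<in>Units R. strongly_nil_clean_elem R (u \<otimes> a)" by blast
qed

text \<open>The inverse is the finite geometric series in \<open>i\<close>. The induction produces
  its partial sums \<open>s\<close> together with both telescoping identities.\<close>

lemma one_minus_nilpotent_Units:
  assumes i: "i \<in> carrier R" and n: "i [^] (n::nat) = \<zero>"
  shows "\<one> \<ominus> i \<in> Units R"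
proof -
  have "\<exists>s\<in>carrier R. (\<one> \<ominus> i) \<otimes> s = \<one> \<ominus> i [^] k \<and> s \<otimes> (\<one> \<ominus> i) = \<one> \<ominus> i [^] k" for k :: nat
  proof (induction k)
    case 0 show ?case by (rule bexI[of _ \<zero>]) (use i in \<open>auto simp: minus_eq r_neg\<close>)
  next
    case (Suc k)
    then obtain s where s: "s \<in> carrier R" "(\<one> \<ominus> i) \<otimes> s = \<one> \<ominus> i [^] k" "s \<otimes> (\<one> \<ominus> i) = \<one> \<ominus> i [^] k" by blast
    have c: "i \<otimes> i [^] k = i [^] k \<otimes> i" using i pow_commute[of i i] by simp
    have t: "\<one> \<ominus> x \<oplus> (x \<ominus> y) = \<one> \<ominus> y" if "x \<in> carrier R" "y \<in> carrier R" for x y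
      using that by algebra
    have "(\<one> \<ominus> i) \<otimes> (s \<oplus> i [^] k) = \<one> \<ominus> i [^] k \<oplus> (i [^] k \<ominus> i [^] k \<otimes> i)"
      using i s by (simp add: r_distr) (simp add: l_distr minus_eq l_minus c)
    moreover have "(s \<oplus> i [^] k) \<otimes> (\<one> \<ominus> i) = \<one> \<ominus> i [^] k \<oplus> (i [^] k \<ominus> i [^] k \<otimes> i)"
      using i s by (simp add: l_distr) (simp add: r_distr minus_eq r_minus)
    ultimately show ?case using i s t by (intro bexI[of _ "s \<oplus> i [^] k"]) auto
  qed
  then obtain s where "s \<in> carrier R" "(\<one> \<ominus> i) \<otimes> s = \<one>" "s \<otimes> (\<one> \<ominus> i) = \<one>"
    using n by (metis minus_eq minus_zero one_closed r_zero)
  then show ?thesis using i unfolding Units_def by auto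
qed

text \<open>Inverting the two products yields a right inverse \<open>y \<otimes> p\<close> and a
  left inverse \<open>q \<otimes> y\<close> of \<open>x\<close>, and these coincide.\<close>

lemma Units_of_mult_Units:
  assumes x: "x \<in> carrier R" and y: "y \<in> carrier R" and "x \<otimes> y \<in> Units R" "y \<otimes> x \<in> Units R"
  shows "x \<in> Units R"
proof -
  obtain p where p: "p \<in> carrier R" "x \<otimes> y \<otimes> p = \<one>" using assms(3) unfolding Units_def by blast
  obtain q where q: "q \<in> carrier R" "q \<otimes> (y \<otimes> x) = \<one>" using assms(4) unfolding Units_def by blast
  have r: "x \<otimes> (y \<otimes> p) = \<one>" using p x y by (simp add: m_assoc)
  have l: "q \<otimes> y \<otimes> x = \<one>" using q x y by (simp add: m_assoc)
  have "q \<otimes> y = q \<otimes> y \<otimes> (x \<otimes> (y \<otimes> p))" using r q y by simp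
  also have "\<dots> = q \<otimes> y \<otimes> x \<otimes> (y \<otimes> p)" using p(1) q(1) x y by (simp add: m_assoc)
  also have "\<dots> = y \<otimes> p" using l p y by simp
  finally have "q \<otimes> y = y \<otimes> p" .
  then show ?thesis using r l x y p unfolding Units_def by auto
qed
end

section \<open>Lifting along a T-nilpotent kernel\<close>

context ring
begin

section \<open>Partial products of a sequence\<close>

lemma prod_lr_closed [simp]:
  "(\<And>i. c i \<in> carrier R) \<Longrightarrow> prod_lr R c n \<in> carrier R"
  by (induction n) auto

lemma prod_lr_add:
  assumes "\<And>i. c i \<in> carrier R"
  shows "prod_lr R c (m + n) = prod_lr R c m \<otimes> prod_lr R (\<lambda>i. c (m + i)) n"
  using assms by (induction n) (auto simp: m_assoc)

text \<open>Serves to apply T-nilpotency to factors that are not themselves in the T-nilpotent set,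
  but whose products over blocks of length \<open>p\<close> are.\<close>

lemma prod_lr_blocks:
  assumes "\<And>i. c i \<in> carrier R"
  shows "prod_lr R (\<lambda>i. prod_lr R (\<lambda>j. c (i * p + j)) p) n = prod_lr R c (n * p)"
proof (induction n)
  case (Suc n)
  have "prod_lr R c (Suc n * p) = prod_lr R c (n * p + p)" by (simp add: add.commute)
  then show ?case using Suc by (simp only: prod_lr_add[OF assms] prod_lr.simps)
qed simp

lemma prod_lr_const: "prod_lr R (\<lambda>_. x) n = x [^] n"
  by (induction n) auto

text \<open>Apply T-nilpotency to the constant sequence, whose partial products are the powers of
  \<open>x\<close>.\<close>

lemma left_T_nilpotent_nil:
  assumes "left_T_nilpotent R A" "x \<in> A"
  shows "\<exists>n::nat. x [^] n = \<zero>"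
proof -
  have "range (\<lambda>_::nat. x) \<subseteq> A" using assms(2) by auto
  then show ?thesis using assms(1) unfolding left_T_nilpotent_def by (metis prod_lr_const)
qed

end

section \<open>Lifting units, idempotents and strong \<pi>-regularity along a surjection\<close>

context ring_hom_ring
begin

lemma hom_minus: "x \<in> carrier R \<Longrightarrow> y \<in> carrier R \<Longrightarrow> h (x \<ominus> y) = h x \<ominus>\<^bsub>S\<^esub> h y"
  by (simp add: R.minus_eq S.minus_eq)

lemma hom_prod_lr: "(\<And>i. c i \<in> carrier R) \<Longrightarrow> h (prod_lr R c n) = prod_lr S (\<lambda>i. h (c i)) n"
  by (induction n) auto

text \<open>Lift the inverse of \<open>h x\<close> to some \<open>y\<close>. Both
  \<open>x \<otimes> y\<close> and \<open>y \<otimes> x\<close> map to 1, so they differ from 1 by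
  nilpotents and are units; hence so is \<open>x\<close>.\<close>

lemma Units_lift_nil_kernel:
  assumes surj: "h ` carrier R = carrier S"
    and nil: "\<And>x. x \<in> carrier R \<Longrightarrow> h x = \<zero>\<^bsub>S\<^esub> \<Longrightarrow> \<exists>n::nat. x [^] n = \<zero>"
    and x: "x \<in> carrier R" and u: "h x \<in> Units S"
  shows "x \<in> Units R"
proof -
  obtain y where y: "y \<in> carrier R" "h y = inv\<^bsub>S\<^esub> (h x)"
    using surj S.Units_inv_closed[OF u] by (metis imageE)
  have 1: "z \<in> Units R" if z: "z \<in> carrier R" "h z = \<one>\<^bsub>S\<^esub>" for z
  proof -
    have "h (\<one> \<ominus> z) = \<zero>\<^bsub>S\<^esub>" using z by (simp add: hom_minus S.minus_eq S.r_neg)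
    then obtain n :: nat where "(\<one> \<ominus> z) [^] n = \<zero>" using nil z by blast
    then have "\<one> \<ominus> (\<one> \<ominus> z) \<in> Units R" using R.one_minus_nilpotent_Units z by simp
    moreover have "\<one> \<ominus> (\<one> \<ominus> z) = z" using z by algebra
    ultimately show ?thesis by simp
  qed
  show ?thesis
    by (rule R.Units_of_mult_Units[OF x y(1)]) (use 1 x y u in auto)
qed

text \<open>With \<open>y = 1 - x\<close> and \<open>(x y)\<^sup>n = 0\<close>, the lift is \<open>x\<^sup>n (x\<^sup>n + y\<^sup>n)\<inverse>\<close>.\<close>

lemma idempotent_lift_nil_kernel:
  assumes surj: "h ` carrier R = carrier S"
    and nil: "\<And>x. x \<in> carrier R \<Longrightarrow> h x = \<zero>\<^bsub>S\<^esub> \<Longrightarrow> \<exists>n::nat. x [^] n = \<zero>"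
    and e: "e \<in> carrier S" "e \<otimes>\<^bsub>S\<^esub> e = e"
  obtains e' where "e' \<in> carrier R" "e' \<otimes> e' = e'" "h e' = e"
proof -
  obtain x where x[simp]: "x \<in> carrier R" and hx: "h x = e" using surj e by (metis imageE)
  define y where "y = \<one> \<ominus> x"
  have y[simp]: "y \<in> carrier R" by (simp add: y_def)
  have xy: "x \<otimes> y = y \<otimes> x" by (simp add: y_def R.minus_eq R.r_distr R.l_distr R.r_minus R.l_minus)
  have hy: "h y = \<one>\<^bsub>S\<^esub> \<ominus>\<^bsub>S\<^esub> e" by (simp add: y_def hom_minus hx)
  have yy: "h y \<otimes>\<^bsub>S\<^esub> h y = h y"
    unfolding hy using e by (simp add: S.minus_eq S.r_distr S.l_distr S.r_minus S.l_minus S.r_neg)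
  have "h (x \<otimes> y) = \<zero>\<^bsub>S\<^esub>"
    by (simp add: hx hy e S.minus_eq S.r_distr S.r_minus S.r_neg)
  then obtain m :: nat where "(x \<otimes> y) [^] m = \<zero>" using nil[of "x \<otimes> y"] by auto
  \<comment> \<open>A positive exponent is needed: the images of \<open>x\<close> and
    \<open>y\<close> are idempotent, so their positive powers are again \<open>e\<close> and
    \<open>1 - e\<close>, and \<open>p \<oplus> q\<close> maps to 1.\<close>
  then have xyn: "(x \<otimes> y) [^] Suc m = \<zero>" by simp
  define p where "p = x [^] Suc m"
  define q where "q = y [^] Suc m"
  have p[simp]: "p \<in> carrier R" and q[simp]: "q \<in> carrier R" by (auto simp: p_def q_def)
  have pq: "p \<otimes> q = \<zero>" using R.commuting_pow_mult[OF x y xy] xyn unfolding p_def q_def by metis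
  have qp: "q \<otimes> p = \<zero>" using R.commuting_pow_mult[OF y x xy[symmetric]] xyn xy unfolding p_def q_def by metis
  have hp: "h p = e" unfolding p_def using S.idem_pow[OF e] by (simp only: hom_nat_pow[OF x] hx)
  have hq: "h q = h y" unfolding q_def using S.idem_pow[OF _ yy] by (simp only: hom_nat_pow[OF y] hom_closed y)
  have hs: "h (p \<oplus> q) = \<one>\<^bsub>S\<^esub>"
    using e S.a_lcomm[of e "\<one>\<^bsub>S\<^esub>" "\<ominus>\<^bsub>S\<^esub> e"] by (simp add: hp hq hy S.minus_eq S.r_neg)
  then have u: "p \<oplus> q \<in> Units R" by (intro Units_lift_nil_kernel[OF surj nil]) auto
  define c where "c = inv (p \<oplus> q)"
  have c[simp]: "c \<in> carrier R" using u by (simp add: c_def)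
  have c1: "(p \<oplus> q) \<otimes> c = \<one>" "c \<otimes> (p \<oplus> q) = \<one>" using u by (simp_all add: c_def)
  have comm: "(p \<oplus> q) \<otimes> p = p \<otimes> (p \<oplus> q)" by (simp add: R.l_distr R.r_distr pq qp)
  have pc: "p \<otimes> c = c \<otimes> p"
  proof -
    have "p \<otimes> c = c \<otimes> ((p \<oplus> q) \<otimes> p) \<otimes> c" by (simp add: R.m_assoc[symmetric] c1)
    also have "\<dots> = c \<otimes> p \<otimes> ((p \<oplus> q) \<otimes> c)" by (simp only: comm R.m_assoc R.m_closed p q c R.add.m_closed)
    finally show ?thesis by (simp add: c1)
  qed
  show ?thesis
  proof
    show "p \<otimes> c \<in> carrier R" by simp
    have "p \<otimes> c \<otimes> (p \<otimes> c) = c \<otimes> (p \<otimes> p) \<otimes> c" by (simp add: pc R.m_assoc)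
    \<comment> \<open>This holds as \<open>q \<otimes> p = \<zero>\<close>; the factor
      \<open>p \<oplus> q\<close> so introduced cancels against its inverse
      \<open>c\<close>.\<close>
    also have "p \<otimes> p = (p \<oplus> q) \<otimes> p" by (simp add: R.l_distr qp)
    also have "c \<otimes> ((p \<oplus> q) \<otimes> p) \<otimes> c = c \<otimes> (p \<oplus> q) \<otimes> (p \<otimes> c)" by (simp only: R.m_assoc R.m_closed p q c R.add.m_closed)
    finally show "p \<otimes> c \<otimes> (p \<otimes> c) = p \<otimes> c" by (simp add: c1)
    have "h c = \<one>\<^bsub>S\<^esub>" using c1(1) hs by (metis R.add.m_closed S.l_one c hom_closed hom_mult hom_one p q)
    then show "h (p \<otimes> c) = e" by (simp add: hp e)
  qed
qed

text \<open>The elements \<open>g k\<close> are the idempotent generators of the left ideals \<open>R e a\<^sup>k\<close> that are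
  congruent to \<open>e\<close> modulo the kernel.\<close>

lemma strongly_pi_regular_lift_aux:
  assumes surj: "h ` carrier R = carrier S"
    and T: "left_T_nilpotent R {x \<in> carrier R. h x = \<zero>\<^bsub>S\<^esub>}"
    and a: "a \<in> carrier R" and "strongly_pi_regular_elem S (h a)"
  obtains g v N where "g \<in> carrier R" "v \<in> carrier R" "g \<otimes> g = g" "g \<otimes> a \<otimes> g = g \<otimes> a"
    "v \<otimes> g \<otimes> a = g" "g \<otimes> a \<otimes> v \<otimes> g = g" "g \<otimes> v \<otimes> g = v \<otimes> g" "(a \<otimes> (\<one> \<ominus> g)) [^] (N::nat) = \<zero>"
proof -
  note [simp] = a
  have nil: "\<exists>n::nat. x [^] n = \<zero>" if "x \<in> carrier R" "h x = \<zero>\<^bsub>S\<^esub>" for x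
    using R.left_T_nilpotent_nil[OF T] that by blast
  obtain b n where b[simp]: "b \<in> carrier S" and n: "(n::nat) \<ge> 1" and ab: "h a \<otimes>\<^bsub>S\<^esub> b = b \<otimes>\<^bsub>S\<^esub> h a"
    and bab: "b \<otimes>\<^bsub>S\<^esub> (h a \<otimes>\<^bsub>S\<^esub> b) = b" and an: "h a [^]\<^bsub>S\<^esub> n \<otimes>\<^bsub>S\<^esub> (h a \<otimes>\<^bsub>S\<^esub> b) = h a [^]\<^bsub>S\<^esub> n"
    using S.strongly_pi_regular_elem_drazin[OF _ assms(4)] by auto
  obtain m where nm: "n = Suc m" using n by (cases n) auto
  define E where "E = h a \<otimes>\<^bsub>S\<^esub> b"
  have E[simp]: "E \<in> carrier S" by (simp add: E_def)
  have EE: "E \<otimes>\<^bsub>S\<^esub> E = E" unfolding E_def by (simp add: S.m_assoc bab)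
  have Ea: "E \<otimes>\<^bsub>S\<^esub> h a = h a \<otimes>\<^bsub>S\<^esub> E" unfolding E_def by (simp add: S.m_assoc ab[symmetric])
  have bE: "b \<otimes>\<^bsub>S\<^esub> E = b" using bab by (simp add: E_def)
  have Eb: "E \<otimes>\<^bsub>S\<^esub> b = b" using bab by (simp add: E_def ab S.m_assoc)
  obtain e where e[simp]: "e \<in> carrier R" and ee: "e \<otimes> e = e" and he: "h e = E"
    using idempotent_lift_nil_kernel[OF surj nil E EE] by blast
  \<comment> \<open>The equations \<open>e g = g\<close> and \<open>g e = e\<close> say that
    \<open>g\<close> is an idempotent with the same right ideal as \<open>e\<close>. Thus the right
    ideal stays fixed along the construction, while the left ideal \<open>R g\<close>
    varies.\<close>
  define P where "P g \<longleftrightarrow> g \<in> carrier R \<and> e \<otimes> g = g \<and> g \<otimes> e = e \<and> h g = E" for g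
  \<comment> \<open>\<open>v\<close> is the inverse of \<open>g a e\<close> in the corner ring
    \<open>e R e\<close>. The next idempotent \<open>v g a\<close> generates the left ideal
    \<open>R g a\<close>.\<close>
  have step: "\<exists>v\<in>carrier R. e \<otimes> v = v \<and> v \<otimes> e = v \<and> v \<otimes> (g \<otimes> a \<otimes> e) = e \<and> g \<otimes> a \<otimes> e \<otimes> v = e
      \<and> P (v \<otimes> g \<otimes> a)" if g: "P g" for g
  proof -
    have gc[simp]: "g \<in> carrier R" and eg: "e \<otimes> g = g" and ge: "g \<otimes> e = e" and hg: "h g = E"
      using g by (auto simp: P_def)
    define t where "t = g \<otimes> a \<otimes> e"
    \<comment> \<open>Adding \<open>1 - e\<close> turns invertibility of \<open>t\<close> in the
      corner into invertibility in \<open>R\<close>. The image of \<open>T\<close> has the inverse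
      \<open>b + (1 - E)\<close>, so \<open>T\<close> is a unit by lifting, and its inverse commutes
      with \<open>e\<close>.\<close>
    define T where "T = t \<oplus> (\<one> \<ominus> e)"
    have t[simp]: "t \<in> carrier R" and Tc[simp]: "T \<in> carrier R" by (auto simp: t_def T_def)
    have et: "e \<otimes> t = t" by (simp add: t_def R.m_assoc[symmetric] eg)
    have te: "t \<otimes> e = t" by (simp add: t_def R.m_assoc ee)
    have eT: "e \<otimes> T = t" by (simp add: T_def R.r_distr R.minus_eq R.r_minus ee R.r_neg et)
    have Te: "T \<otimes> e = t" by (simp add: T_def R.l_distr R.minus_eq R.l_minus ee R.r_neg te)
    have ht: "h t = E \<otimes>\<^bsub>S\<^esub> h a"
      by (simp add: t_def hg he S.m_assoc Ea[symmetric]) (simp add: S.m_assoc[symmetric] EE)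
    define F where "F = \<one>\<^bsub>S\<^esub> \<ominus>\<^bsub>S\<^esub> E"
    have F[simp]: "F \<in> carrier S" by (simp add: F_def)
    have EF: "E \<otimes>\<^bsub>S\<^esub> F = \<zero>\<^bsub>S\<^esub>" and FE: "F \<otimes>\<^bsub>S\<^esub> E = \<zero>\<^bsub>S\<^esub>"
      by (simp_all add: F_def S.minus_eq S.r_distr S.l_distr S.r_minus S.l_minus EE S.r_neg)
    have FF: "F \<otimes>\<^bsub>S\<^esub> F = F" using FE
      unfolding F_def by (simp add: S.minus_eq S.r_distr S.l_distr S.r_minus S.l_minus EE S.r_neg)
    have EFs: "E \<oplus>\<^bsub>S\<^esub> F = \<one>\<^bsub>S\<^esub>"
      unfolding F_def using S.a_lcomm[of E "\<one>\<^bsub>S\<^esub>" "\<ominus>\<^bsub>S\<^esub> E"] by (simp add: S.minus_eq S.r_neg)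
    have bF: "b \<otimes>\<^bsub>S\<^esub> F = \<zero>\<^bsub>S\<^esub>" and Fb: "F \<otimes>\<^bsub>S\<^esub> b = \<zero>\<^bsub>S\<^esub>"
      unfolding F_def by (simp_all add: S.minus_eq S.r_distr S.l_distr S.r_minus S.l_minus bE Eb S.r_neg)
    have hT: "h T = E \<otimes>\<^bsub>S\<^esub> h a \<oplus>\<^bsub>S\<^esub> F" by (simp add: T_def ht hom_minus he F_def)
    have 1: "E \<otimes>\<^bsub>S\<^esub> h a \<otimes>\<^bsub>S\<^esub> b = E" by (simp add: S.m_assoc EE flip: E_def)
    have 2: "b \<otimes>\<^bsub>S\<^esub> (E \<otimes>\<^bsub>S\<^esub> h a) = E" by (simp add: S.m_assoc[symmetric] bE flip: ab E_def)
    have 3: "E \<otimes>\<^bsub>S\<^esub> h a \<otimes>\<^bsub>S\<^esub> F = \<zero>\<^bsub>S\<^esub>" by (simp add: Ea S.m_assoc EF)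
    have 4: "F \<otimes>\<^bsub>S\<^esub> (E \<otimes>\<^bsub>S\<^esub> h a) = \<zero>\<^bsub>S\<^esub>" by (simp add: S.m_assoc[symmetric] FE)
    have "h T \<otimes>\<^bsub>S\<^esub> (b \<oplus>\<^bsub>S\<^esub> F) = \<one>\<^bsub>S\<^esub>" "(b \<oplus>\<^bsub>S\<^esub> F) \<otimes>\<^bsub>S\<^esub> h T = \<one>\<^bsub>S\<^esub>"
      unfolding hT by (simp_all add: S.l_distr S.r_distr 1 2 3 4 bF Fb FF EFs)
    then have "h T \<in> Units S" unfolding Units_def
      using S.add.m_closed[OF b F] hom_closed[OF Tc] by blast
    then have U: "T \<in> Units R" by (intro Units_lift_nil_kernel[OF surj nil]) auto
    define w where "w = inv T"
    have w[simp]: "w \<in> carrier R" using U by (simp add: w_def)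
    have Tw: "T \<otimes> w = \<one>" "w \<otimes> T = \<one>" using U by (simp_all add: w_def)
    have ew: "e \<otimes> w = w \<otimes> e"
    proof -
      have "e \<otimes> w = w \<otimes> (T \<otimes> e) \<otimes> w" by (simp add: R.m_assoc[symmetric] Tw)
      also have "T \<otimes> e = e \<otimes> T" by (simp add: eT Te)
      also have "w \<otimes> (e \<otimes> T) \<otimes> w = w \<otimes> e \<otimes> (T \<otimes> w)" by (simp only: R.m_assoc R.m_closed w e Tc)
      finally show ?thesis by (simp add: Tw)
    qed
    define v where "v = w \<otimes> e"
    have v[simp]: "v \<in> carrier R" by (simp add: v_def)
    have ve: "v \<otimes> e = v" by (simp add: v_def R.m_assoc ee)
    have ev: "e \<otimes> v = v" by (simp add: v_def flip: ew) (simp add: R.m_assoc[symmetric] ee)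
    have vt: "v \<otimes> t = e"
      by (simp add: v_def R.m_assoc et) (simp add: R.m_assoc[symmetric] Tw flip: Te)
    have tv: "t \<otimes> v = e"
      by (simp add: v_def R.m_assoc[symmetric] te flip: ew) (simp add: R.m_assoc Tw flip: eT)
    have "P (v \<otimes> g \<otimes> a)" unfolding P_def
    proof (intro conjI)
      show "e \<otimes> (v \<otimes> g \<otimes> a) = v \<otimes> g \<otimes> a" by (simp add: R.m_assoc[symmetric] ev)
      show "v \<otimes> g \<otimes> a \<otimes> e = e" using vt by (simp add: t_def R.m_assoc)
      have "h (v \<otimes> g \<otimes> a) = h v \<otimes>\<^bsub>S\<^esub> h t" by (simp add: ht hg S.m_assoc)
      then show "h (v \<otimes> g \<otimes> a) = E" using vt he by (metis hom_mult t v)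
    qed simp
    then show ?thesis using v ve ev vt tv unfolding t_def by blast
  qed
  then obtain v where v: "\<And>g. P g \<Longrightarrow> v g \<in> carrier R \<and> e \<otimes> v g = v g \<and> v g \<otimes> e = v g
     \<and> v g \<otimes> (g \<otimes> a \<otimes> e) = e \<and> g \<otimes> a \<otimes> e \<otimes> v g = e \<and> P (v g \<otimes> g \<otimes> a)" by metis
  define g where "g = rec_nat e (\<lambda>_ g. v g \<otimes> g \<otimes> a)"
  have gs: "g (Suc k) = v (g k) \<otimes> g k \<otimes> a" for k by (simp add: g_def)
  have Pg: "P (g k)" for k
  proof (induction k)
    case 0 then show ?case by (simp add: g_def P_def ee he)
  next
    case (Suc k) then show ?case unfolding gs using v by blast
  qed
  define V where "V k = v (g k)" for k
  have gc[simp]: "g k \<in> carrier R" and eg: "e \<otimes> g k = g k" and ge: "g k \<otimes> e = e" and hg: "h (g k) = E" for k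
    using Pg[of k] by (auto simp: P_def)
  have V[simp]: "V k \<in> carrier R" and eV: "e \<otimes> V k = V k" and Ve: "V k \<otimes> e = V k"
    and Vg: "V k \<otimes> (g k \<otimes> a \<otimes> e) = e" and gV: "g k \<otimes> a \<otimes> e \<otimes> V k = e"
    and gV_Suc: "g (Suc k) = V k \<otimes> g k \<otimes> a" for k
    using v[OF Pg[of k]] by (auto simp: V_def gs)
  \<comment> \<open>Each \<open>g i\<close> acts as a left identity on the common right ideal
    \<open>e R\<close>, which contains every \<open>g j\<close>.\<close>
  have gg: "g i \<otimes> g j = g j" for i j
  proof -
    have "g i \<otimes> g j = g i \<otimes> e \<otimes> g j" by (simp add: R.m_assoc eg)
    then show ?thesis by (simp add: ge eg)
  qed
  define c where "c j = a \<otimes> (\<one> \<ominus> g (Suc j))" for j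
  have c[simp]: "c j \<in> carrier R" for j by (simp add: c_def)
  define d where "d k = g (Suc k) \<ominus> g k" for k
  have d[simp]: "d k \<in> carrier R" for k by (simp add: d_def)
  \<comment> \<open>Expand \<open>v1 (g1 - g0) a (1 - g1)\<close>. Here \<open>v1 g1 a = g2\<close>,
    and \<open>g2 g1 = g1\<close> because all these idempotents share a right ideal; the two terms
    with \<open>g0\<close> cancel since \<open>v1 g0 a g1 = v1 g0 a\<close>.\<close>
  have d_Suc: "d (Suc k) = V (Suc k) \<otimes> d k \<otimes> c k" for k
  proof -
    define g0 g1 g2 v0 v1 where "g0 = g k" and "g1 = g (Suc k)" and "g2 = g (Suc (Suc k))"
      and "v0 = V k" and "v1 = V (Suc k)"
    note gdefs = this
    have [simp]: "g0 \<in> carrier R" "g1 \<in> carrier R" "g2 \<in> carrier R" "v0 \<in> carrier R" "v1 \<in> carrier R"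
      by (auto simp: gdefs)
    have g1: "g1 = v0 \<otimes> g0 \<otimes> a" and g2: "g2 = v1 \<otimes> g1 \<otimes> a" using gV_Suc by (auto simp: gdefs)
    have A: "v1 \<otimes> g1 \<otimes> a \<otimes> g1 = g1" unfolding g2[symmetric] by (simp add: gdefs gg)
    have "v1 \<otimes> g0 \<otimes> a \<otimes> g1 = v1 \<otimes> g0 \<otimes> a \<otimes> (e \<otimes> (v0 \<otimes> g0 \<otimes> a))"
      using eg[of "Suc k"] by (simp add: g1[symmetric]) (simp add: gdefs)
    also have "\<dots> = v1 \<otimes> (g0 \<otimes> a \<otimes> e \<otimes> v0) \<otimes> (g0 \<otimes> a)" by (simp add: R.m_assoc)
    also have "\<dots> = v1 \<otimes> g0 \<otimes> a" using gV[of k] by (simp add: gdefs Ve R.m_assoc[symmetric])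
    finally have B: "v1 \<otimes> g0 \<otimes> a \<otimes> g1 = v1 \<otimes> g0 \<otimes> a" .
    have "v1 \<otimes> (g1 \<ominus> g0) \<otimes> (a \<otimes> (\<one> \<ominus> g1))
       = v1 \<otimes> g1 \<otimes> a \<ominus> v1 \<otimes> g0 \<otimes> a \<ominus> v1 \<otimes> g1 \<otimes> a \<otimes> g1 \<oplus> v1 \<otimes> g0 \<otimes> a \<otimes> g1"
      by (simp add: R.minus_eq R.r_distr R.l_distr R.r_minus R.l_minus R.m_assoc R.minus_add R.a_ac)
    also have "\<dots> = g2 \<ominus> v1 \<otimes> g0 \<otimes> a \<ominus> g1 \<oplus> v1 \<otimes> g0 \<otimes> a" by (simp add: A B g2)
    also have "\<dots> = g2 \<ominus> g1"
    proof -
      have "x \<ominus> y \<ominus> z \<oplus> y = x \<ominus> z" if "x \<in> carrier R" "y \<in> carrier R" "z \<in> carrier R" for x y z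
        using that by algebra
      then show ?thesis by simp
    qed
    finally show ?thesis by (simp add: d_def c_def gdefs)
  qed
  \<comment> \<open>Iterating the recursion collects the factors \<open>c 0\<close>, ...,
    \<open>c (k - 1)\<close> in order on the right, which is the order of
    \<open>prod_lr\<close>.\<close>
  have "\<exists>W\<in>carrier R. d k = W \<otimes> prod_lr R c k" for k
  proof (induction k)
    case 0 show ?case by (rule bexI[of _ "d 0"]) auto
  next
    case (Suc k)
    then obtain W where W: "W \<in> carrier R" "d k = W \<otimes> prod_lr R c k" by blast
    show ?case by (rule bexI[of _ "V (Suc k) \<otimes> W"]) (use W in \<open>auto simp: d_Suc R.m_assoc\<close>)
  qed
  note d_prod = this
  define F where "F = \<one>\<^bsub>S\<^esub> \<ominus>\<^bsub>S\<^esub> E"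
  have F[simp]: "F \<in> carrier S" by (simp add: F_def)
  have FF: "F \<otimes>\<^bsub>S\<^esub> F = F"
    unfolding F_def by (simp add: S.minus_eq S.r_distr S.l_distr S.r_minus S.l_minus EE S.r_neg)
  have hF: "h (a \<otimes> (\<one> \<ominus> g k)) = h a \<otimes>\<^bsub>S\<^esub> F" for k by (simp add: hom_minus hg F_def)
  have Fn: "(h a \<otimes>\<^bsub>S\<^esub> F) [^]\<^bsub>S\<^esub> n = \<zero>\<^bsub>S\<^esub>"
  proof -
    have "h a \<otimes>\<^bsub>S\<^esub> F = F \<otimes>\<^bsub>S\<^esub> h a"
      unfolding F_def by (simp add: S.minus_eq S.r_distr S.l_distr S.r_minus S.l_minus Ea)
    then have "(h a \<otimes>\<^bsub>S\<^esub> F) [^]\<^bsub>S\<^esub> n = h a [^]\<^bsub>S\<^esub> n \<otimes>\<^bsub>S\<^esub> F [^]\<^bsub>S\<^esub> n"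
      by (intro S.commuting_pow_mult) auto
    also have "F [^]\<^bsub>S\<^esub> n = F" using S.idem_pow[OF F FF] by (simp only: nm)
    also have "h a [^]\<^bsub>S\<^esub> n \<otimes>\<^bsub>S\<^esub> F = \<zero>\<^bsub>S\<^esub>"
      using an unfolding F_def by (simp add: S.minus_eq S.r_distr S.r_minus S.r_neg flip: E_def)
    finally show ?thesis .
  qed
  \<comment> \<open>Every \<open>c j\<close> has the image \<open>h a \<otimes> F\<close>, whose
    \<open>n\<close>-th power vanishes. So each block of \<open>n\<close> consecutive factors lies
    in the kernel, and T-nilpotency kills a product of finitely many blocks.\<close>
  define c' where "c' i = prod_lr R (\<lambda>j. c (i * n + j)) n" for i
  have "range c' \<subseteq> {x \<in> carrier R. h x = \<zero>\<^bsub>S\<^esub>}"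
    unfolding c'_def by (auto simp: hom_prod_lr c_def hF S.prod_lr_const Fn)
  then obtain k where "prod_lr R c' k = \<zero>" using T unfolding left_T_nilpotent_def by blast
  then have "prod_lr R c (k * n) = \<zero>"
    unfolding c'_def by (subst (asm) R.prod_lr_blocks) auto
  then have "d (k * n) = \<zero>" using d_prod[of "k * n"] by auto
  \<comment> \<open>At the index \<open>k * n\<close> two consecutive idempotents coincide, so
    \<open>W G a = G\<close>. All required identities follow from this fixed-point equation.\<close>
  define G where "G = g (k * n)"
  define W where "W = V (k * n)"
  have G[simp]: "G \<in> carrier R" and W[simp]: "W \<in> carrier R" by (auto simp: G_def W_def)
  have "W \<otimes> G \<otimes> a \<ominus> G = \<zero>" using \<open>d (k * n) = \<zero>\<close> unfolding d_def gV_Suc G_def W_def .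
  then have WGa: "W \<otimes> G \<otimes> a = G" by simp
  have GG: "G \<otimes> G = G" and eG: "e \<otimes> G = G" and Ge: "G \<otimes> e = e" by (auto simp: G_def gg eg ge)
  have GaeW: "G \<otimes> a \<otimes> e \<otimes> W = e" and eW: "e \<otimes> W = W" using gV eV by (auto simp: G_def W_def)
  have "G \<otimes> a \<otimes> G = G \<otimes> a \<otimes> (e \<otimes> (W \<otimes> G \<otimes> a))" by (simp add: WGa eG)
  also have "\<dots> = G \<otimes> a \<otimes> e \<otimes> W \<otimes> (G \<otimes> a)" by (simp add: R.m_assoc)
  also have "\<dots> = G \<otimes> a" unfolding GaeW by (simp add: R.m_assoc[symmetric] eG)
  finally have GaG: "G \<otimes> a \<otimes> G = G \<otimes> a" .
  have "G \<otimes> a \<otimes> W \<otimes> G = G \<otimes> a \<otimes> (e \<otimes> W) \<otimes> G" by (simp add: eW)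
  also have "\<dots> = G \<otimes> a \<otimes> e \<otimes> W \<otimes> G" by (simp add: R.m_assoc)
  finally have GaWG: "G \<otimes> a \<otimes> W \<otimes> G = G" by (simp add: GaeW eG)
  have "G \<otimes> W \<otimes> G = G \<otimes> (e \<otimes> W) \<otimes> G" by (simp add: eW)
  also have "\<dots> = G \<otimes> e \<otimes> W \<otimes> G" by (simp add: R.m_assoc)
  finally have GWG: "G \<otimes> W \<otimes> G = W \<otimes> G" by (simp add: Ge eW)
  \<comment> \<open>The complementary block is nilpotent only modulo the kernel at first; the kernel
    being nil, a further power vanishes in \<open>R\<close>.\<close>
  have "h ((a \<otimes> (\<one> \<ominus> G)) [^] n) = \<zero>\<^bsub>S\<^esub>" by (simp add: hom_nat_pow G_def hF Fn del: hom_mult)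
  then obtain m' :: nat where "((a \<otimes> (\<one> \<ominus> G)) [^] n) [^] m' = \<zero>" using nil by (metis G R.minus_closed R.nat_pow_closed R.one_closed R.m_closed a)
  then have "(a \<otimes> (\<one> \<ominus> G)) [^] (n * m') = \<zero>" by (simp add: R.nat_pow_pow)
  then show thesis by (intro that[of G W]) (auto simp: GG GaG WGa GaWG GWG)
qed

text \<open>Relative to \<open>g\<close> and \<open>f = 1 - g\<close> one has
  \<open>g a f = 0\<close>. The block \<open>f a f = a f\<close> is nilpotent, and
  \<open>v g\<close> inverts the block \<open>g a\<close>, so a high power of \<open>a\<close> only
  sees the invertible block.\<close>

lemma strongly_pi_regular_lift:
  assumes "h ` carrier R = carrier S"
    and "left_T_nilpotent R {x \<in> carrier R. h x = \<zero>\<^bsub>S\<^esub>}"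
    and a: "a \<in> carrier R" and "strongly_pi_regular_elem S (h a)"
  shows "strongly_pi_regular_elem R a"
proof -
  obtain g v N where g[simp]: "g \<in> carrier R" and v[simp]: "v \<in> carrier R"
    and gg: "g \<otimes> g = g" and gag: "g \<otimes> a \<otimes> g = g \<otimes> a" and vga: "v \<otimes> g \<otimes> a = g"
    and gavg: "g \<otimes> a \<otimes> v \<otimes> g = g" and gvg: "g \<otimes> v \<otimes> g = v \<otimes> g"
    and N: "(a \<otimes> (\<one> \<ominus> g)) [^] (N::nat) = \<zero>"
    using strongly_pi_regular_lift_aux[OF assms] by blast
  note [simp] = a
  define f where "f = \<one> \<ominus> g"
  have f[simp]: "f \<in> carrier R" by (simp add: f_def)
  have ff: "f \<otimes> f = f"
    unfolding f_def by (simp add: R.minus_eq R.r_distr R.l_distr R.r_minus R.l_minus gg R.r_neg)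
  have gaf: "g \<otimes> a \<otimes> f = \<zero>"
    unfolding f_def by (simp add: R.minus_eq R.r_distr R.r_minus gag R.r_neg)
  have "f \<otimes> a \<otimes> f = a \<otimes> f \<ominus> g \<otimes> a \<otimes> f"
  proof -
    have "(\<one> \<ominus> g) \<otimes> a \<otimes> x = a \<otimes> x \<ominus> g \<otimes> a \<otimes> x" if "x \<in> carrier R" for x
      using that by (simp add: R.minus_eq R.l_distr R.l_minus)
    then show ?thesis by (simp flip: f_def)
  qed
  then have faf: "f \<otimes> a \<otimes> f = a \<otimes> f" by (simp add: gaf R.minus_eq)
  have "(a \<otimes> f) [^] Suc k = a [^] Suc k \<otimes> f" for k
  proof (induction k)
    case (Suc k)
    have "(a \<otimes> f) [^] Suc (Suc k) = a [^] Suc k \<otimes> (f \<otimes> a \<otimes> f)"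
      by (simp only: R.nat_pow_Suc[of _ "Suc k"] Suc) (simp add: R.m_assoc)
    then show ?case unfolding faf by (simp add: R.m_assoc)
  qed simp
  \<comment> \<open>The successor ensures \<open>n \<ge> 1\<close>, which both the power formula and
    strong \<pi>-regularity require.\<close>
  moreover define n where "n = Suc N"
  ultimately have "a [^] n \<otimes> f = \<zero>" using N by (metis R.l_null R.m_closed R.nat_pow_Suc a f f_def)
  then have ang: "a [^] n \<otimes> g = a [^] n"
    by (simp add: f_def R.minus_eq R.r_distr R.r_minus) (simp flip: R.minus_eq)
  define U where "U = v \<otimes> g"
  have U[simp]: "U \<in> carrier R" by (simp add: U_def)
  have Uga: "U \<otimes> (g \<otimes> a) = g" using vga gg by (simp add: U_def R.m_assoc) (metis R.m_assoc a g gg)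
  have gU: "g \<otimes> U = U" using gvg by (simp add: U_def R.m_assoc)
  have gaU: "g \<otimes> a \<otimes> U = g" using gavg by (simp add: U_def R.m_assoc)
  have L: "U [^] k \<otimes> (g \<otimes> a [^] k) = g" for k :: nat
  proof (induction k)
    case (Suc k)
    have "a [^] Suc k = a \<otimes> a [^] k" using R.pow_commute[of a a k] by simp
    then have "U [^] Suc k \<otimes> (g \<otimes> a [^] Suc k) = U [^] k \<otimes> (U \<otimes> (g \<otimes> a)) \<otimes> a [^] k"
      by (simp add: R.m_assoc)
    then show ?case using Suc by (simp add: Uga R.m_assoc)
  qed simp
  \<comment> \<open>Right multiplication by \<open>a\<close> keeps the left ideal generated by
    \<open>g\<close> stable, hence so do its powers. This allows a factor \<open>g\<close> to be
    inserted after \<open>g a [^] k\<close>.\<close>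
  have gakg: "g \<otimes> a [^] k \<otimes> g = g \<otimes> a [^] k" for k :: nat
  proof (induction k)
    case (Suc k)
    have "g \<otimes> a [^] Suc k \<otimes> g = (g \<otimes> a [^] k) \<otimes> a \<otimes> g" by (simp add: R.m_assoc)
    also have "\<dots> = (g \<otimes> a [^] k) \<otimes> (g \<otimes> a \<otimes> g)" by (subst Suc[symmetric]) (simp add: R.m_assoc)
    also have "\<dots> = (g \<otimes> a [^] k \<otimes> g) \<otimes> a" unfolding gag by (simp add: R.m_assoc)
    finally show ?case by (simp add: Suc R.m_assoc)
  qed (simp add: gg)
  have Rr: "g \<otimes> a [^] k \<otimes> (g \<otimes> U [^] k) = g" for k :: nat
  proof (induction k)
    case (Suc k)
    have "U [^] Suc k = U \<otimes> U [^] k" using R.pow_commute[of U U k] by simp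
    then have "g \<otimes> a [^] Suc k \<otimes> (g \<otimes> U [^] Suc k) = g \<otimes> a [^] k \<otimes> a \<otimes> (g \<otimes> U) \<otimes> U [^] k"
      by (simp add: R.m_assoc)
    also have "\<dots> = g \<otimes> a [^] k \<otimes> g \<otimes> a \<otimes> U \<otimes> U [^] k" by (simp add: gU gakg)
    also have "\<dots> = g \<otimes> a [^] k \<otimes> (g \<otimes> a \<otimes> U) \<otimes> U [^] k" by (simp add: R.m_assoc)
    also have "\<dots> = g \<otimes> a [^] k \<otimes> (g \<otimes> U [^] k)" unfolding gaU by (simp add: R.m_assoc)
    finally show ?case by (simp add: Suc)
  qed (simp add: gg)
  \<comment> \<open>Now \<open>\<alpha> g = \<alpha>\<close>, and \<open>W\<close> inverts
    \<open>g \<alpha>\<close> on the block of \<open>g\<close>. The right witness \<open>g W\<close>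
    cancels one \<open>\<alpha>\<close>; the left witness \<open>\<alpha> W g W g\<close> cancels
    two and restores one.\<close>
  define \<alpha> W where "\<alpha> = a [^] n" and "W = U [^] n"
  have [simp]: "\<alpha> \<in> carrier R" "W \<in> carrier R" by (auto simp: \<alpha>_def W_def)
  have ag: "\<alpha> \<otimes> g = \<alpha>" using ang by (simp add: \<alpha>_def)
  have L': "W \<otimes> g \<otimes> \<alpha> = g" using L[of n] by (simp add: \<alpha>_def W_def R.m_assoc)
  have R': "g \<otimes> \<alpha> \<otimes> (g \<otimes> W) = g" using Rr[of n] by (simp add: \<alpha>_def W_def)
  have "\<alpha> \<otimes> \<alpha> \<otimes> (g \<otimes> W) = \<alpha> \<otimes> g \<otimes> \<alpha> \<otimes> (g \<otimes> W)" by (simp add: ag)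
  also have "\<dots> = \<alpha> \<otimes> (g \<otimes> \<alpha> \<otimes> (g \<otimes> W))" by (simp add: R.m_assoc)
  finally have 1: "\<alpha> \<otimes> \<alpha> \<otimes> (g \<otimes> W) = \<alpha>" by (simp add: R' ag)
  have "\<alpha> \<otimes> W \<otimes> g \<otimes> W \<otimes> g \<otimes> (\<alpha> \<otimes> \<alpha>) = \<alpha> \<otimes> (W \<otimes> g \<otimes> (W \<otimes> g \<otimes> \<alpha>) \<otimes> \<alpha>)" by (simp add: R.m_assoc)
  also have "\<dots> = \<alpha> \<otimes> (W \<otimes> (g \<otimes> g) \<otimes> \<alpha>)" unfolding L' by (simp add: R.m_assoc)
  finally have 2: "\<alpha> \<otimes> W \<otimes> g \<otimes> W \<otimes> g \<otimes> (\<alpha> \<otimes> \<alpha>) = \<alpha>" by (simp add: gg L' ag)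
  show ?thesis unfolding strongly_pi_regular_elem_def
    by (intro exI[of _ n] conjI bexI[of _ "\<alpha> \<otimes> W \<otimes> g \<otimes> W \<otimes> g"] bexI[of _ "g \<otimes> W"])
      (use 1 2 in \<open>auto simp: n_def \<alpha>_def\<close>)
qed

end

section \<open>Opposite rings and spans of T-nilpotent sets\<close>

text \<open>Reduces right T-nilpotency to left T-nilpotency. Only the multiplication field is
  updated, so the additive structure and finite sums are literally unchanged.\<close>

definition opposite_ring :: "('a, 'm) ring_scheme \<Rightarrow> ('a, 'm) ring_scheme" where
  "opposite_ring S = S\<lparr>monoid.mult := (\<lambda>x y. y \<otimes>\<^bsub>S\<^esub> x)\<rparr>"

lemma opposite_ring_simps [simp]:
  "carrier (opposite_ring S) = carrier S" "\<one>\<^bsub>opposite_ring S\<^esub> = \<one>\<^bsub>S\<^esub>"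
  "\<zero>\<^bsub>opposite_ring S\<^esub> = \<zero>\<^bsub>S\<^esub>" "x \<oplus>\<^bsub>opposite_ring S\<^esub> y = x \<oplus>\<^bsub>S\<^esub> y"
  "x \<otimes>\<^bsub>opposite_ring S\<^esub> y = y \<otimes>\<^bsub>S\<^esub> x"
  "finsum (opposite_ring S) = finsum S" "Units (opposite_ring S) = Units S"
  by (auto simp: opposite_ring_def fun_eq_iff finsum_def finprod_def Units_def)

context ring
begin

lemma opposite_ring_ring: "ring (opposite_ring R)"
proof (rule ringI)
  have "add_monoid (opposite_ring R) = add_monoid R" by (simp add: opposite_ring_def)
  then show "abelian_group (opposite_ring R)"
    using abelian_group_axioms unfolding abelian_group_def abelian_group_axioms_def abelian_monoid_def by simp
  show "monoid (opposite_ring R)" by (rule monoidI) (auto simp: m_assoc)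
qed (auto simp: l_distr r_distr)

lemma opposite_ring_nat_pow:
  assumes "x \<in> carrier R" shows "x [^]\<^bsub>opposite_ring R\<^esub> (n::nat) = x [^] n"
proof -
  interpret O: ring "opposite_ring R" by (rule opposite_ring_ring)
  show ?thesis by (induction n) (use assms pow_commute[OF assms assms] in auto)
qed

text \<open>Reversing the multiplication exchanges the roles of the witnesses \<open>y\<close> and
  \<open>z\<close>.\<close>

lemma opposite_ring_strongly_pi_regular_elem:
  assumes "x \<in> carrier R"
  shows "strongly_pi_regular_elem (opposite_ring R) x \<longleftrightarrow> strongly_pi_regular_elem R x"
  unfolding strongly_pi_regular_elem_def
  by (simp add: opposite_ring_nat_pow assms m_assoc[symmetric]) (auto simp: assms m_assoc)

lemma opposite_ring_left_T_nilpotent: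
  "left_T_nilpotent (opposite_ring R) A \<longleftrightarrow> right_T_nilpotent R A"
proof -
  have "prod_lr (opposite_ring R) a n = prod_rl R a n" for a n by (induction n) auto
  then show ?thesis unfolding left_T_nilpotent_def right_T_nilpotent_def by simp
qed

text \<open>The argument is that of Koenig's lemma: if \<open>c 0 \<otimes> \<dots> \<otimes> c (n - 1)\<close> never
  vanishes, then coefficients can be chosen one after the other so that their products \<open>s\<close>
  keep \<open>s \<otimes> c i \<otimes> \<dots> \<otimes> c (i + n - 1)\<close> nonzero for all \<open>n\<close>.\<close>

lemma left_T_nilpotent_span:
  assumes T: "left_T_nilpotent R A" and A: "A \<subseteq> carrier R" and H: "finite H"
    and \<delta>: "\<And>h. h \<in> H \<Longrightarrow> \<delta> h \<in> Units R"
    and comm: "\<And>h r. h \<in> H \<Longrightarrow> r \<in> A \<Longrightarrow> r \<otimes> \<delta> h = \<delta> h \<otimes> r"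
    and K: "K \<subseteq> carrier R"
    and span: "\<And>x. x \<in> K \<Longrightarrow> \<exists>r. (\<forall>h\<in>H. r h \<in> A) \<and> x = (\<Oplus>h\<in>H. r h \<otimes> \<delta> h)"
  shows "left_T_nilpotent R K"
  unfolding left_T_nilpotent_def
proof (intro allI impI)
  fix c :: "nat \<Rightarrow> 'a" assume "range c \<subseteq> K"
  then have cK: "c i \<in> K" for i by auto
  then have c[simp]: "c i \<in> carrier R" for i using K by auto
  obtain r where rA: "\<And>i h. h \<in> H \<Longrightarrow> r i h \<in> A" and cr: "\<And>i. c i = (\<Oplus>h\<in>H. r i h \<otimes> \<delta> h)"
    using span[OF cK] by metis
  have r[simp]: "r i h \<in> carrier R" if "h \<in> H" for i h using rA[OF that] A by blast
  have \<delta>c[simp]: "\<delta> h \<in> carrier R" if "h \<in> H" for h using \<delta>[OF that] by (rule Units_closed)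
  define P where "P i n = prod_lr R (\<lambda>j. c (i + j)) n" for i n
  have P[simp]: "P i n \<in> carrier R" for i n by (simp add: P_def)
  have P_Suc: "P i (Suc n) = c i \<otimes> P (Suc i) n" for i n
    using prod_lr_add[of "\<lambda>j. c (i + j)" 1 n] by (simp add: P_def)
  \<comment> \<open>An element \<open>s\<close> is good at stage \<open>i\<close> if it annihilates
    no product of factors starting at \<open>c i\<close>. Commutation with all
    \<open>\<delta> h\<close> is carried along so that units can be moved out of the way.\<close>
  define Q where "Q i s \<longleftrightarrow> s \<in> carrier R \<and> (\<forall>h\<in>H. s \<otimes> \<delta> h = \<delta> h \<otimes> s) \<and> (\<forall>n. s \<otimes> P i n \<noteq> \<zero>)" for i s
  have step: "\<exists>k\<in>H. Q (Suc i) (s \<otimes> r i k)" if Q: "Q i s" for i s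
  proof (rule ccontr)
    assume neg: "\<not> ?thesis"
    have s[simp]: "s \<in> carrier R" and sd: "\<And>h. h \<in> H \<Longrightarrow> s \<otimes> \<delta> h = \<delta> h \<otimes> s" using Q by (auto simp: Q_def)
    have srd: "s \<otimes> r i k \<otimes> \<delta> h = \<delta> h \<otimes> (s \<otimes> r i k)" if "k \<in> H" "h \<in> H" for k h
    proof -
      have "s \<otimes> r i k \<otimes> \<delta> h = s \<otimes> \<delta> h \<otimes> r i k" using that comm[OF that(2) rA[OF that(1)]] by (simp add: m_assoc)
      then show ?thesis using that by (simp add: sd m_assoc)
    qed
    then have "\<exists>n. s \<otimes> r i k \<otimes> P (Suc i) n = \<zero>" if "k \<in> H" for k using neg that by (auto simp: Q_def)
    then obtain n where n: "\<And>k. k \<in> H \<Longrightarrow> s \<otimes> r i k \<otimes> P (Suc i) (n k) = \<zero>" by metis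
    \<comment> \<open>One length for all \<open>k\<close> in the finite set \<open>H\<close>: once a
      product is annihilated, so are all its prolongations to the right.\<close>
    define N where "N = Max (insert 0 (n ` H))"
    have N: "s \<otimes> r i k \<otimes> P (Suc i) N = \<zero>" if k: "k \<in> H" for k
    proof -
      have "n k \<le> N" unfolding N_def using H k by (intro Max_ge) auto
      then obtain l where "N = n k + l" using le_Suc_ex by blast
      then have "P (Suc i) N = P (Suc i) (n k) \<otimes> prod_lr R (\<lambda>j. c (Suc i + (n k + j))) l"
        by (simp add: P_def prod_lr_add)
      then have "s \<otimes> r i k \<otimes> P (Suc i) N = s \<otimes> r i k \<otimes> P (Suc i) (n k) \<otimes> prod_lr R (\<lambda>j. c (Suc i + (n k + j))) l"
        using k by (simp add: m_assoc)
      then show ?thesis using n[OF k] by simp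
    qed
    have "s \<otimes> P i (Suc N) = s \<otimes> ((\<Oplus>h\<in>H. r i h \<otimes> \<delta> h) \<otimes> P (Suc i) N)" by (simp only: P_Suc cr)
    also have "\<dots> = (\<Oplus>h\<in>H. s \<otimes> (r i h \<otimes> \<delta> h \<otimes> P (Suc i) N))"
      using H by (simp add: finsum_ldistr finsum_rdistr Pi_def)
    \<comment> \<open>In each summand \<open>\<delta> h\<close> is moved to the far left, past
      \<open>s\<close> and the coefficient, leaving a product that \<open>N\<close>
      annihilates.\<close>
    also have "\<dots> = (\<Oplus>h\<in>H. \<zero>)"
    proof (rule finsum_cong')
      fix h assume h: "h \<in> H"
      have "s \<otimes> (r i h \<otimes> \<delta> h \<otimes> P (Suc i) N) = s \<otimes> r i h \<otimes> \<delta> h \<otimes> P (Suc i) N" using h by (simp add: m_assoc)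
      also have "\<dots> = \<delta> h \<otimes> (s \<otimes> r i h \<otimes> P (Suc i) N)" unfolding srd[OF h h] using h by (simp add: m_assoc)
      finally show "s \<otimes> (r i h \<otimes> \<delta> h \<otimes> P (Suc i) N) = \<zero>" using N[OF h] h by simp
    qed auto
    finally show False using Q by (simp add: Q_def)
  qed
  show "\<exists>n\<ge>1. prod_lr R c n = \<zero>"
  proof (rule ccontr)
    assume neg: "\<not> ?thesis"
    have "Q 0 \<one>"
      unfolding Q_def
    proof (intro conjI allI ballI)
      fix n
      \<comment> \<open>The assumption speaks of lengths at least 1. Arguing through the successor
        also covers length 0, as a vanishing product would stay zero.\<close>
      have "P 0 (Suc n) \<noteq> \<zero>" using neg unfolding P_def by auto
      then show "\<one> \<otimes> P 0 n \<noteq> \<zero>" by (auto simp: P_def)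
    qed auto
    then have "\<exists>s. (\<forall>i. Q i (s i)) \<and> (\<forall>i. \<exists>k\<in>H. s (Suc i) = s i \<otimes> r i k) \<and> s 0 = \<one>"
    proof -
      \<comment> \<open>The clause at \<open>i = 0\<close> fixes the start at 1, so that
        \<open>s i\<close> becomes exactly the product of the first \<open>i\<close> chosen
        coefficients.\<close>
      have "\<exists>s. \<forall>i. (Q i (s i) \<and> (i = 0 \<longrightarrow> s i = \<one>)) \<and> (\<exists>k\<in>H. s (Suc i) = s i \<otimes> r i k)"
      proof (rule dependent_nat_choice)
        show "\<exists>s. Q 0 s \<and> (0 = 0 \<longrightarrow> s = \<one>)" using \<open>Q 0 \<one>\<close> by blast
        show "\<exists>s'. (Q (Suc i) s' \<and> (Suc i = 0 \<longrightarrow> s' = \<one>)) \<and> (\<exists>k\<in>H. s' = s \<otimes> r i k)"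
          if "Q i s \<and> (i = 0 \<longrightarrow> s = \<one>)" for s i
          using step[of i s] that by blast
      qed
      then show ?thesis by blast
    qed
    then obtain s where s: "\<And>i. Q i (s i)" "\<And>i. \<exists>k\<in>H. s (Suc i) = s i \<otimes> r i k" "s 0 = \<one>" by blast
    then obtain k where k: "\<And>i. k i \<in> H" "\<And>i. s (Suc i) = s i \<otimes> r i (k i)" by metis
    have "s i = prod_lr R (\<lambda>i. r i (k i)) i" for i by (induction i) (simp_all add: s k)
    moreover have "range (\<lambda>i. r i (k i)) \<subseteq> A" using rA k by auto
    ultimately obtain n where "s n = \<zero>" using T unfolding left_T_nilpotent_def by metis
    then show False using s(1)[of n] by (auto simp: Q_def)
  qed
qed

end

lemma (in ring_hom_ring) opposite_ring_hom: "ring_hom_ring (opposite_ring R) (opposite_ring S) h"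
  by (rule ring_hom_ringI2[OF R.opposite_ring_ring S.opposite_ring_ring]) (auto simp: ring_hom_def)

text \<open>The kernel inherits T-nilpotency from the coefficient set \<open>A\<close>. In the
  right-sided case the argument runs in the opposite rings; the commutation of coefficients with
  \<open>\<delta> i\<close> turns the given spanning sums into sums with reversed factors.\<close>

lemma (in ring_hom_ring) strongly_pi_regular_lift_span:
  assumes surj: "h ` carrier R = carrier S"
    and T: "left_T_nilpotent R A \<or> right_T_nilpotent R A" and A: "A \<subseteq> carrier R" and H: "finite H"
    and \<delta>: "\<And>i. i \<in> H \<Longrightarrow> \<delta> i \<in> Units R"
    and comm: "\<And>i r. i \<in> H \<Longrightarrow> r \<in> A \<Longrightarrow> r \<otimes> \<delta> i = \<delta> i \<otimes> r"
    and span: "\<And>x. x \<in> carrier R \<Longrightarrow> h x = \<zero>\<^bsub>S\<^esub> \<Longrightarrow> \<exists>r. (\<forall>i\<in>H. r i \<in> A) \<and> x = (\<Oplus>i\<in>H. r i \<otimes> \<delta> i)"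
    and a: "a \<in> carrier R" and spr: "strongly_pi_regular_elem S (h a)"
  shows "strongly_pi_regular_elem R a"
  using T
proof
  assume "left_T_nilpotent R A"
  then have "left_T_nilpotent R {x \<in> carrier R. h x = \<zero>\<^bsub>S\<^esub>}"
    by (rule R.left_T_nilpotent_span[OF _ A H \<delta> comm]) (use span in auto)
  then show ?thesis by (rule strongly_pi_regular_lift[OF surj _ a spr])
next
  interpret O: ring_hom_ring "opposite_ring R" "opposite_ring S" h by (rule opposite_ring_hom)
  have span': "\<exists>r. (\<forall>i\<in>H. r i \<in> A) \<and> x = (\<Oplus>i\<in>H. \<delta> i \<otimes> r i)" if x: "x \<in> carrier R" "h x = \<zero>\<^bsub>S\<^esub>" for x
  proof -
    obtain r where r: "\<forall>i\<in>H. r i \<in> A" "x = (\<Oplus>i\<in>H. r i \<otimes> \<delta> i)" using span[OF x] by blast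
    have "(\<Oplus>i\<in>H. r i \<otimes> \<delta> i) = (\<Oplus>i\<in>H. \<delta> i \<otimes> r i)"
      using r(1) A \<delta> comm by (intro R.finsum_cong') (auto intro!: R.m_closed)
    then show ?thesis using r by auto
  qed
  assume "right_T_nilpotent R A"
  then have "left_T_nilpotent (opposite_ring R) A" by (simp add: R.opposite_ring_left_T_nilpotent)
  then have "left_T_nilpotent (opposite_ring R) {x \<in> carrier R. h x = \<zero>\<^bsub>S\<^esub>}"
    by (rule O.R.left_T_nilpotent_span[OF _ _ H, where \<delta>=\<delta>]) (use A \<delta> comm span' in auto)
  then have "strongly_pi_regular_elem (opposite_ring R) a"
    using surj a spr by (intro O.strongly_pi_regular_lift) (auto simp: S.opposite_ring_strongly_pi_regular_elem)
  then show ?thesis by (simp add: R.opposite_ring_strongly_pi_regular_elem a)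
qed

section \<open>Chains of left ideals in semisimple rings\<close>

text \<open>Negatives arise from left multiplication by \<open>\<ominus> \<one>\<close>.\<close>

lemma left_idealI:
  fixes R (structure)
  assumes "ring R" "I \<subseteq> carrier R" "\<zero>\<^bsub>R\<^esub> \<in> I"
    "\<And>x y. x \<in> I \<Longrightarrow> y \<in> I \<Longrightarrow> x \<oplus>\<^bsub>R\<^esub> y \<in> I"
    "\<And>x r. x \<in> I \<Longrightarrow> r \<in> carrier R \<Longrightarrow> r \<otimes>\<^bsub>R\<^esub> x \<in> I"
  shows "left_ideal I R"
proof -
  interpret ring R by fact
  have "subgroup I (add_monoid R)"
  proof (rule add.subgroupI)
    fix x assume x: "x \<in> I"
    have "(\<ominus> \<one>) \<otimes> x \<in> I" using assms(5) x by simp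
    moreover have "(\<ominus> \<one>) \<otimes> x = \<ominus> x" using x assms(2) by (auto simp: l_minus)
    ultimately show "\<ominus> x \<in> I" by simp
  qed (use assms in auto)
  then show ?thesis
    by (simp add: left_ideal_def left_ideal_axioms_def additive_subgroup_def assms ring_axioms)
qed

context left_ideal
begin

lemma subset_carrier: "x \<in> I \<Longrightarrow> x \<in> carrier R"
  using a_subset by blast

lemma minus_closed_ideal: "x \<in> I \<Longrightarrow> y \<in> I \<Longrightarrow> x \<ominus> y \<in> I"
  by (simp add: minus_eq)

end

lemma semisimple_complement:
  fixes R (structure)
  assumes "semisimple_ring R" "left_ideal I R"
  obtains K where "left_ideal K R" "I \<inter> K = {\<zero>\<^bsub>R\<^esub>}"
    "\<And>x. x \<in> carrier R \<Longrightarrow> \<exists>i\<in>I. \<exists>k\<in>K. x = i \<oplus>\<^bsub>R\<^esub> k"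
proof -
  obtain K where "left_ideal K R" "I \<inter> K = {\<zero>\<^bsub>R\<^esub>}" "I <+>\<^bsub>R\<^esub> K = carrier R"
    using assms unfolding semisimple_ring_def by blast
  then show ?thesis by (intro that[of K]) (fastforce simp: set_add_def set_mult_def)+
qed

text \<open>Let \<open>K\<close> complement the union and write \<open>1 = l + k\<close> with
  \<open>l\<close> in some \<open>L m\<close>. For \<open>x\<close> in the union,
  \<open>x k = x - x l\<close> lies in the union and in \<open>K\<close>, so it is zero and
  \<open>x = x l\<close> lies in \<open>L m\<close>.\<close>

lemma semisimple_ascending_chain:
  fixes R (structure)
  assumes ss: "semisimple_ring R" and L: "\<And>n. left_ideal (L n) R" and inc: "\<And>n. L n \<subseteq> L (Suc n)"
  shows "\<exists>m. \<forall>n\<ge>m. L n = L m"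
proof -
  interpret ring R using ss by (simp add: semisimple_ring_def)
  interpret L: left_ideal "L n" R for n by (rule L)
  have mono: "m \<le> n \<Longrightarrow> L m \<subseteq> L n" for m n using inc by (rule lift_Suc_mono_le)
  have "left_ideal (\<Union>n. L n) R"
  proof (rule left_idealI)
    fix x y assume "x \<in> (\<Union>n. L n)" "y \<in> (\<Union>n. L n)"
    then obtain m n where "x \<in> L m" "y \<in> L n" by blast
    then have "x \<in> L (max m n)" "y \<in> L (max m n)" using mono by (meson max.cobounded1 max.cobounded2 subsetD)+
    then show "x \<oplus> y \<in> (\<Union>n. L n)" by blast
  qed (use L.subset_carrier L.I_l_closed ring_axioms in auto)
  then obtain K where K: "left_ideal K R" "(\<Union>n. L n) \<inter> K = {\<zero>}"
    and "\<And>x. x \<in> carrier R \<Longrightarrow> \<exists>i\<in>(\<Union>n. L n). \<exists>k\<in>K. x = i \<oplus> k"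
    using semisimple_complement[OF ss] by metis
  then obtain l k where "l \<in> (\<Union>n. L n)" and k: "k \<in> K" and lk: "\<one> = l \<oplus> k" by (metis one_closed)
  then obtain m where l: "l \<in> L m" by blast
  interpret K: left_ideal K R by (rule K)
  have "L n \<subseteq> L m" for n
  proof
    fix x assume x: "x \<in> L n"
    have c[simp]: "x \<in> carrier R" "l \<in> carrier R" "k \<in> carrier R" using x l k L.subset_carrier K.subset_carrier by auto
    have "x = x \<otimes> (l \<oplus> k)" by (simp flip: lk)
    then have x2: "x = x \<otimes> l \<oplus> x \<otimes> k" by (simp add: r_distr)
    have "x \<otimes> k = x \<ominus> x \<otimes> l"
      by (subst (2) x2) (simp add: minus_eq a_comm[of "x \<otimes> l"] a_assoc r_neg)
    moreover have "x \<in> L (max m n)" "x \<otimes> l \<in> L (max m n)"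
      using x l mono L.I_l_closed by (meson c max.cobounded1 max.cobounded2 subsetD)+
    ultimately have "x \<otimes> k \<in> L (max m n)" using L.minus_closed_ideal by metis
    moreover have "x \<otimes> k \<in> K" using K.I_l_closed k by simp
    ultimately have "x \<otimes> k = \<zero>" using K(2) by blast
    then have "x = x \<otimes> l" using x2 by simp
    then show "x \<in> L m" using l L.I_l_closed by (metis c(1))
  qed
  then show ?thesis using mono by (intro exI[of _ m]) blast
qed

text \<open>Complements of the members of a descending chain can be chosen increasing, by the modular
  law.\<close>

lemma semisimple_descending_chain:
  fixes R (structure)
  assumes ss: "semisimple_ring R" and L: "\<And>n. left_ideal (L n) R" and dec: "\<And>n. L (Suc n) \<subseteq> L n"
  shows "\<exists>m. \<forall>n\<ge>m. L n = L m"
proof -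
  interpret ring R using ss by (simp add: semisimple_ring_def)
  interpret L: left_ideal "L n" R for n by (rule L)
  have anti: "m \<le> n \<Longrightarrow> L n \<subseteq> L m" for m n using dec by (rule lift_Suc_antimono_le)
  define compl where "compl I C \<longleftrightarrow> left_ideal C R \<and> I \<inter> C = {\<zero>} \<and> (\<forall>x\<in>carrier R. \<exists>i\<in>I. \<exists>k\<in>C. x = i \<oplus> k)" for I C
  have "\<exists>C'. compl (L (Suc n)) C' \<and> C \<subseteq> C'" if C: "compl (L n) C" for n C
  proof -
    interpret C: left_ideal C R using C by (simp add: compl_def)
    obtain K where K: "left_ideal K R" and LK: "L (Suc n) \<inter> K = {\<zero>}"
      and sK: "\<And>x. x \<in> carrier R \<Longrightarrow> \<exists>i\<in>L (Suc n). \<exists>k\<in>K. x = i \<oplus> k"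
      using semisimple_complement[OF ss L[of "Suc n"]] by metis
    interpret K: left_ideal K R by (rule K)
    \<comment> \<open>This is \<open>C + (K \<inter> L n)\<close>: the part of \<open>K\<close>
      inside \<open>L n\<close> complements \<open>L (Suc n)\<close> within \<open>L n\<close>, and
      \<open>C\<close> supplies the rest.\<close>
    define C' where "C' = {c \<oplus> k | c k. c \<in> C \<and> k \<in> K \<and> k \<in> L n}"
    have C'I: "c \<oplus> k \<in> C'" if "c \<in> C" "k \<in> K" "k \<in> L n" for c k
      using that unfolding C'_def by blast
    have "left_ideal C' R"
    proof (rule left_idealI)
      show "C' \<subseteq> carrier R" using C.subset_carrier K.subset_carrier by (auto simp: C'_def)
      have "\<zero> = \<zero> \<oplus> \<zero>" by simp
      then show "\<zero> \<in> C'" using C'I[OF C.zero_closed K.zero_closed L.zero_closed] by simp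
    next
      fix x y assume "x \<in> C'" "y \<in> C'"
      then obtain c k c' k' where *: "x = c \<oplus> k" "c \<in> C" "k \<in> K" "k \<in> L n" "y = c' \<oplus> k'" "c' \<in> C" "k' \<in> K" "k' \<in> L n"
        unfolding C'_def by blast
      then have "x \<oplus> y = (c \<oplus> c') \<oplus> (k \<oplus> k')" using C.subset_carrier K.subset_carrier by (simp add: a_ac)
      then show "x \<oplus> y \<in> C'" using * C'I by simp
    next
      fix x r assume "x \<in> C'" and r: "r \<in> carrier R"
      then obtain c k where *: "x = c \<oplus> k" "c \<in> C" "k \<in> K" "k \<in> L n" unfolding C'_def by blast
      then have "r \<otimes> x = r \<otimes> c \<oplus> r \<otimes> k" using C.subset_carrier K.subset_carrier r by (simp add: r_distr)
      then show "r \<otimes> x \<in> C'" using * r C'I C.I_l_closed K.I_l_closed L.I_l_closed by simp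
    qed (rule ring_axioms)
    moreover have "L (Suc n) \<inter> C' \<subseteq> {\<zero>}"
    proof
      fix x assume "x \<in> L (Suc n) \<inter> C'"
      then obtain c k where *: "x \<in> L (Suc n)" "x = c \<oplus> k" "c \<in> C" "k \<in> K" "k \<in> L n" unfolding C'_def by blast
      then have cc: "c \<in> carrier R" "k \<in> carrier R" using C.subset_carrier K.subset_carrier by auto
      have "c = x \<ominus> k" using cc by (simp add: * minus_eq a_assoc r_neg)
      moreover have "x \<in> L n" using * dec by blast
      ultimately have "c \<in> L n" using *(5) L.minus_closed_ideal by blast
      then have "c = \<zero>" using C *(3) by (auto simp: compl_def)
      then have "x \<in> K" using * cc by simp
      then show "x \<in> {\<zero>}" using * LK by blast
    qed
    moreover have "\<exists>i\<in>L (Suc n). \<exists>k\<in>C'. x = i \<oplus> k" if x: "x \<in> carrier R" for x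
    proof -
      obtain l c where lc: "l \<in> L n" "c \<in> C" "x = l \<oplus> c" using C x by (auto simp: compl_def)
      obtain i k where ik: "i \<in> L (Suc n)" "k \<in> K" "l = i \<oplus> k" using sK lc L.subset_carrier by metis
      have cc: "l \<in> carrier R" "c \<in> carrier R" "i \<in> carrier R" "k \<in> carrier R"
        using lc ik C.subset_carrier K.subset_carrier L.subset_carrier by auto
      have "k = l \<ominus> i" using cc by (simp add: ik minus_eq a_comm[of i] a_assoc r_neg)
      then have "k \<in> L n" using lc(1) ik(1) dec L.minus_closed_ideal by (metis subsetD)
      then have "c \<oplus> k \<in> C'" using lc ik C'I by blast
      moreover have "x = i \<oplus> (c \<oplus> k)" unfolding lc(3) using cc by (simp add: ik(3) a_ac)
      ultimately show ?thesis using ik(1) by blast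
    qed
    moreover have "C \<subseteq> C'"
    proof
      fix c assume c: "c \<in> C"
      then have "c = c \<oplus> \<zero>" using C.subset_carrier by simp
      then show "c \<in> C'" using C'I[OF c K.zero_closed L.zero_closed] by simp
    qed
    moreover have "\<zero> \<in> L (Suc n)" by simp
    moreover have "\<zero> \<in> C'" using \<open>left_ideal C' R\<close> by (simp add: left_ideal_def additive_subgroup.zero_closed)
    ultimately show ?thesis unfolding compl_def by blast
  qed
  note step = this
  obtain C0 where "compl (L 0) C0" unfolding compl_def by (rule semisimple_complement[OF ss L[of 0]]) blast
  then have "\<exists>C. \<forall>n. compl (L n) (C n) \<and> C n \<subseteq> C (Suc n)"
    using step by (intro dependent_nat_choice) auto
  then obtain C where C: "\<And>n. compl (L n) (C n)" "\<And>n. C n \<subseteq> C (Suc n)" by blast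
  then obtain m where m: "\<And>n. n \<ge> m \<Longrightarrow> C n = C m"
    using semisimple_ascending_chain[OF ss, of C] C unfolding compl_def by metis
  \<comment> \<open>The complements are already constant. Splitting \<open>x = l + c\<close> along
    \<open>L n\<close> and \<open>C n = C m\<close> gives \<open>c = x - l\<close> in
    \<open>L m \<inter> C m = 0\<close>.\<close>
  have "L m \<subseteq> L n" if n: "n \<ge> m" for n
  proof
    fix x assume x: "x \<in> L m"
    then obtain l c where lc: "l \<in> L n" "c \<in> C n" "x = l \<oplus> c"
      using C(1)[of n] L.subset_carrier unfolding compl_def by blast
    interpret C: left_ideal "C n" R using C(1) by (simp add: compl_def)
    have cc: "l \<in> carrier R" "c \<in> carrier R" using lc L.subset_carrier C.subset_carrier by auto
    have "c = x \<ominus> l" using cc by (simp add: lc(3) minus_eq a_comm[of l] a_assoc r_neg)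
    moreover have "l \<in> L m" using lc anti[OF n] by blast
    ultimately have "c \<in> L m" using x L.minus_closed_ideal by metis
    moreover have "c \<in> C m" using lc m[OF n] by simp
    ultimately have "c = \<zero>" using C(1)[of m] by (auto simp: compl_def)
    then show "x \<in> L n" using lc cc by simp
  qed
  then show ?thesis using anti by (intro exI[of _ m]) blast
qed

section \<open>Group rings\<close>

locale group_ring_setup = ring R + G: group G
  for R :: "('r, 'n) ring_scheme" (structure) and G :: "('g, 'm) monoid_scheme"
begin

abbreviation RG :: "('g \<Rightarrow> 'r) ring" where "RG \<equiv> group_ring R G"

text \<open>The element usually written \<open>r x\<close>. With \<open>x\<close> the identity of
  \<open>G\<close> these are the coefficients, with \<open>r = \<one>\<close> the group
  elements.\<close>

definition monomial :: "'r \<Rightarrow> 'g \<Rightarrow> 'g \<Rightarrow> 'r" where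
  "monomial r x = (\<lambda>g. if g = x then r else \<zero>)"

section \<open>Coefficients, supports and products in the group ring\<close>

lemma carrier_RG_iff:
  "f \<in> carrier RG \<longleftrightarrow> (\<forall>g. f g \<in> carrier R) \<and> (\<forall>g. g \<notin> carrier G \<longrightarrow> f g = \<zero>) \<and> finite {g. f g \<noteq> \<zero>}"
proof -
  have "f g \<in> carrier R" if "f g = \<zero>" for g using that by simp
  then show ?thesis unfolding group_ring_def by auto
qed

lemma RG_coeff_closed [simp]: "f \<in> carrier RG \<Longrightarrow> f g \<in> carrier R"
  by (simp add: carrier_RG_iff)

lemma RG_outside: "f \<in> carrier RG \<Longrightarrow> g \<notin> carrier G \<Longrightarrow> f g = \<zero>"
  by (simp add: carrier_RG_iff)

lemma RG_finite_support: "f \<in> carrier RG \<Longrightarrow> finite {g. f g \<noteq> \<zero>}"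
  by (simp add: carrier_RG_iff)

lemma RG_support_subset: "f \<in> carrier RG \<Longrightarrow> {g. f g \<noteq> \<zero>} \<subseteq> carrier G"
  using RG_outside by blast

lemma RG_eqI:
  assumes "f \<in> carrier RG" "h \<in> carrier RG" "\<And>g. g \<in> carrier G \<Longrightarrow> f g = h g"
  shows "f = h"
proof
  fix g show "f g = h g"
    by (cases "g \<in> carrier G") (simp_all add: assms(3) RG_outside[OF assms(1)] RG_outside[OF assms(2)])
qed

lemma RG_zero: "\<zero>\<^bsub>RG\<^esub> = (\<lambda>g. \<zero>)"
  and RG_one: "\<one>\<^bsub>RG\<^esub> = monomial \<one> \<one>\<^bsub>G\<^esub>"
  and RG_add: "f \<oplus>\<^bsub>RG\<^esub> h = (\<lambda>g. f g \<oplus> h g)"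
  by (simp_all only: group_ring_def monomial_def ring.select_convs monoid.select_convs)

lemma RG_mult: "(f \<otimes>\<^bsub>RG\<^esub> h) g =
    (\<Oplus>p \<in> {(x, y). f x \<noteq> \<zero> \<and> h y \<noteq> \<zero> \<and> x \<otimes>\<^bsub>G\<^esub> y = g}. f (fst p) \<otimes> h (snd p))"
  by (simp only: group_ring_def monoid.select_convs)

text \<open>For given \<open>x\<close> and \<open>g\<close>, the equation \<open>x y = g\<close>
  determines \<open>y\<close>. Allowing any finite \<open>F\<close> containing the support lets
  products of several elements be computed over a common index set.\<close>

lemma RG_mult_eq_sum:
  assumes f: "f \<in> carrier RG" and h: "h \<in> carrier RG" and g: "g \<in> carrier G"
    and F: "finite F" "F \<subseteq> carrier G" "{x. f x \<noteq> \<zero>} \<subseteq> F"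
  shows "(f \<otimes>\<^bsub>RG\<^esub> h) g = (\<Oplus>x\<in>F. f x \<otimes> h (inv\<^bsub>G\<^esub> x \<otimes>\<^bsub>G\<^esub> g))"
proof -
  \<comment> \<open>The indices that contribute a pair to the defining sum; \<open>k\<close> matches
    them with these pairs. The remaining indices of \<open>F\<close> give zero terms.\<close>
  define F' where "F' = {x \<in> F. f x \<noteq> \<zero> \<and> h (inv\<^bsub>G\<^esub> x \<otimes>\<^bsub>G\<^esub> g) \<noteq> \<zero>}"
  define k where "k x = (x, inv\<^bsub>G\<^esub> x \<otimes>\<^bsub>G\<^esub> g)" for x
  have "{(x, y). f x \<noteq> \<zero> \<and> h y \<noteq> \<zero> \<and> x \<otimes>\<^bsub>G\<^esub> y = g} = k ` F'"
  proof (rule equalityI; rule subsetI)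
    fix p assume "p \<in> {(x, y). f x \<noteq> \<zero> \<and> h y \<noteq> \<zero> \<and> x \<otimes>\<^bsub>G\<^esub> y = g}"
    then obtain x y where p: "p = (x, y)" "f x \<noteq> \<zero>" "h y \<noteq> \<zero>" "x \<otimes>\<^bsub>G\<^esub> y = g" by blast
    have x: "x \<in> carrier G" "y \<in> carrier G" using p(2,3) RG_outside[OF f, of x] RG_outside[OF h, of y] by blast+
    then have y: "y = inv\<^bsub>G\<^esub> x \<otimes>\<^bsub>G\<^esub> g" using p(4) G.inv_solve_left[of y x g] g by simp
    moreover have "x \<in> F" using F(3) p(2) by blast
    ultimately have "x \<in> F'" using p(2,3) by (simp add: F'_def)
    moreover have "p = k x" using p(1) y by (simp add: k_def)
    ultimately show "p \<in> k ` F'" by blast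
  next
    fix p assume "p \<in> k ` F'"
    then obtain x where x: "x \<in> F" "f x \<noteq> \<zero>" "h (inv\<^bsub>G\<^esub> x \<otimes>\<^bsub>G\<^esub> g) \<noteq> \<zero>" "p = (x, inv\<^bsub>G\<^esub> x \<otimes>\<^bsub>G\<^esub> g)"
      by (auto simp: F'_def k_def)
    have "x \<otimes>\<^bsub>G\<^esub> (inv\<^bsub>G\<^esub> x \<otimes>\<^bsub>G\<^esub> g) = g" using subsetD[OF F(2) x(1)] g by (simp flip: G.m_assoc)
    then show "p \<in> {(x, y). f x \<noteq> \<zero> \<and> h y \<noteq> \<zero> \<and> x \<otimes>\<^bsub>G\<^esub> y = g}" using x by simp
  qed
  then have "(f \<otimes>\<^bsub>RG\<^esub> h) g = (\<Oplus>p \<in> k ` F'. f (fst p) \<otimes> h (snd p))" by (simp add: RG_mult)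
  also have "\<dots> = (\<Oplus>x\<in>F'. f (fst (k x)) \<otimes> h (snd (k x)))"
    by (rule add.finprod_reindex) (auto simp: k_def inj_on_def f h)
  also have "\<dots> = (\<Oplus>x\<in>F. f x \<otimes> h (inv\<^bsub>G\<^esub> x \<otimes>\<^bsub>G\<^esub> g))"
    by (rule add.finprod_mono_neutral_cong_left) (auto simp: F(1) F'_def k_def f h)
  finally show ?thesis .
qed

lemma RG_mult_closed:
  assumes f: "f \<in> carrier RG" and h: "h \<in> carrier RG"
  shows "f \<otimes>\<^bsub>RG\<^esub> h \<in> carrier RG"
  unfolding carrier_RG_iff
proof (intro conjI allI impI)
  show "(f \<otimes>\<^bsub>RG\<^esub> h) g \<in> carrier R" for g
    unfolding RG_mult by (intro finsum_closed Pi_I) (simp add: f h)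
  have nz: "\<exists>x y. f x \<noteq> \<zero> \<and> h y \<noteq> \<zero> \<and> x \<otimes>\<^bsub>G\<^esub> y = g" if "(f \<otimes>\<^bsub>RG\<^esub> h) g \<noteq> \<zero>" for g
  proof (rule ccontr)
    assume "\<not> ?thesis"
    then have *: "{(x, y). f x \<noteq> \<zero> \<and> h y \<noteq> \<zero> \<and> x \<otimes>\<^bsub>G\<^esub> y = g} = {}" by blast
    show False using that unfolding RG_mult * by simp
  qed
  show "(f \<otimes>\<^bsub>RG\<^esub> h) g = \<zero>" if "g \<notin> carrier G" for g
  proof (rule ccontr)
    assume "(f \<otimes>\<^bsub>RG\<^esub> h) g \<noteq> \<zero>"
    then obtain x y where "f x \<noteq> \<zero>" "h y \<noteq> \<zero>" "x \<otimes>\<^bsub>G\<^esub> y = g" using nz by blast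
    then show False using RG_outside[OF f, of x] RG_outside[OF h, of y] that by auto
  qed
  have "{g. (f \<otimes>\<^bsub>RG\<^esub> h) g \<noteq> \<zero>} \<subseteq> (\<lambda>(x, y). x \<otimes>\<^bsub>G\<^esub> y) ` ({x. f x \<noteq> \<zero>} \<times> {y. h y \<noteq> \<zero>})"
  proof
    fix g assume "g \<in> {g. (f \<otimes>\<^bsub>RG\<^esub> h) g \<noteq> \<zero>}"
    then obtain x y where "f x \<noteq> \<zero>" "h y \<noteq> \<zero>" "x \<otimes>\<^bsub>G\<^esub> y = g" using nz by blast
    then show "g \<in> (\<lambda>(x, y). x \<otimes>\<^bsub>G\<^esub> y) ` ({x. f x \<noteq> \<zero>} \<times> {y. h y \<noteq> \<zero>})"
      by (intro image_eqI[of _ _ "(x, y)"]) auto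
  qed
  then show "finite {g. (f \<otimes>\<^bsub>RG\<^esub> h) g \<noteq> \<zero>}"
    by (rule finite_subset) (simp add: RG_finite_support[OF f] RG_finite_support[OF h])
qed

lemma RG_add_closed:
  assumes f: "f \<in> carrier RG" and h: "h \<in> carrier RG"
  shows "f \<oplus>\<^bsub>RG\<^esub> h \<in> carrier RG"
proof -
  have "{g. f g \<oplus> h g \<noteq> \<zero>} \<subseteq> {g. f g \<noteq> \<zero>} \<union> {g. h g \<noteq> \<zero>}" by auto
  then have "finite {g. f g \<oplus> h g \<noteq> \<zero>}"
    by (rule finite_subset) (simp add: RG_finite_support[OF f] RG_finite_support[OF h])
  then show ?thesis using f h unfolding RG_add carrier_RG_iff by simp
qed

lemma monomial_closed [simp]: "r \<in> carrier R \<Longrightarrow> x \<in> carrier G \<Longrightarrow> monomial r x \<in> carrier RG"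
  by (auto simp: carrier_RG_iff monomial_def intro: finite_subset[of _ "{x}"])

lemma RG_zero_closed: "(\<lambda>g. \<zero>) \<in> carrier RG"
  by (simp add: carrier_RG_iff)

lemma monomial_mult:
  assumes r: "r \<in> carrier R" and x: "x \<in> carrier G" and h: "h \<in> carrier RG" and g: "g \<in> carrier G"
  shows "(monomial r x \<otimes>\<^bsub>RG\<^esub> h) g = r \<otimes> h (inv\<^bsub>G\<^esub> x \<otimes>\<^bsub>G\<^esub> g)"
proof -
  have "{y. monomial r x y \<noteq> \<zero>} \<subseteq> {x}" "monomial r x x = r" by (auto simp: monomial_def)
  then show ?thesis using assms RG_mult_eq_sum[of "monomial r x" h g "{x}"] by simp
qed

lemma monomial_mult_monomial:
  assumes "r \<in> carrier R" "s \<in> carrier R" "x \<in> carrier G" "y \<in> carrier G"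
  shows "monomial r x \<otimes>\<^bsub>RG\<^esub> monomial s y = monomial (r \<otimes> s) (x \<otimes>\<^bsub>G\<^esub> y)"
proof (rule RG_eqI)
  fix g assume g: "g \<in> carrier G"
  have "inv\<^bsub>G\<^esub> x \<otimes>\<^bsub>G\<^esub> g = y \<longleftrightarrow> g = x \<otimes>\<^bsub>G\<^esub> y" using G.inv_solve_left[OF assms(4,3) g] by (subst eq_commute)
  then show "(monomial r x \<otimes>\<^bsub>RG\<^esub> monomial s y) g = monomial (r \<otimes> s) (x \<otimes>\<^bsub>G\<^esub> y) g"
    using assms g by (simp add: monomial_mult) (simp add: monomial_def)
qed (use assms RG_mult_closed in auto)

text \<open>Coefficients are stripped off one at a time, by induction on a finite set
  \<open>A\<close> containing the support. Points of \<open>A\<close> outside \<open>G\<close> carry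
  the coefficient zero and are dropped.\<close>

lemma RG_induct [consumes 1, case_names monomial add]:
  assumes f: "f \<in> carrier RG"
    and mono: "\<And>r x. r \<in> carrier R \<Longrightarrow> x \<in> carrier G \<Longrightarrow> P (monomial r x)"
    and add: "\<And>f h. f \<in> carrier RG \<Longrightarrow> h \<in> carrier RG \<Longrightarrow> P f \<Longrightarrow> P h \<Longrightarrow> P (f \<oplus>\<^bsub>RG\<^esub> h)"
  shows "P f"
proof -
  have "P f" if "finite A" "f \<in> carrier RG" "{g. f g \<noteq> \<zero>} \<subseteq> A" for A f
    using that
  proof (induction A arbitrary: f rule: finite_induct)
    case empty
    then have "f = monomial \<zero> \<one>\<^bsub>G\<^esub>" by (auto simp: monomial_def fun_eq_iff)
    then show ?case using mono by simp
  next
    case (insert x A)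
    show ?case
    proof (cases "x \<in> carrier G")
      case True
      let ?f = "f(x := \<zero>)"
      have "{g. ?f g \<noteq> \<zero>} \<subseteq> {g. f g \<noteq> \<zero>}" by auto
      then have "finite {g. ?f g \<noteq> \<zero>}" by (rule finite_subset) (rule RG_finite_support[OF insert.prems(1)])
      then have f': "?f \<in> carrier RG" using insert.prems(1) unfolding carrier_RG_iff by simp
      have "{g. ?f g \<noteq> \<zero>} \<subseteq> A" using insert.prems(2) by auto
      then have "P ?f" by (rule insert.IH[OF f'])
      moreover have "f = monomial (f x) x \<oplus>\<^bsub>RG\<^esub> ?f"
        using insert.prems(1) by (auto simp: RG_add monomial_def fun_eq_iff)
      moreover have "f x \<in> carrier R" using insert.prems(1) by simp
      ultimately show ?thesis using add[OF monomial_closed[OF _ True] f' mono[OF _ True], of "f x"] by simp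
    next
      case False
      then have "f x = \<zero>" using RG_outside insert.prems by blast
      then have "{g. f g \<noteq> \<zero>} \<subseteq> A" using insert.prems(2) by auto
      then show ?thesis by (rule insert.IH[OF insert.prems(1)])
    qed
  qed
  then show ?thesis using f RG_finite_support by blast
qed

section \<open>The ring axioms for the group ring\<close>

lemma RG_l_distr:
  assumes "f \<in> carrier RG" "k \<in> carrier RG" "h \<in> carrier RG"
  shows "(f \<oplus>\<^bsub>RG\<^esub> k) \<otimes>\<^bsub>RG\<^esub> h = f \<otimes>\<^bsub>RG\<^esub> h \<oplus>\<^bsub>RG\<^esub> k \<otimes>\<^bsub>RG\<^esub> h"
proof (rule RG_eqI)
  fix g assume g: "g \<in> carrier G"
  \<comment> \<open>The union of the supports serves for both factors and for their sum, whose own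
    support may be smaller.\<close>
  define F where "F = {x. f x \<noteq> \<zero>} \<union> {x. k x \<noteq> \<zero>}"
  have F: "finite F" "F \<subseteq> carrier G" using assms(1,2)[THEN RG_finite_support] assms(1,2)[THEN RG_support_subset] by (simp_all add: F_def)
  have "{x. (f \<oplus>\<^bsub>RG\<^esub> k) x \<noteq> \<zero>} \<subseteq> F" by (auto simp: RG_add F_def)
  moreover have "{x. f x \<noteq> \<zero>} \<subseteq> F" "{x. k x \<noteq> \<zero>} \<subseteq> F" by (auto simp: F_def)
  moreover have "(\<Oplus>x\<in>F. (f x \<oplus> k x) \<otimes> h (inv\<^bsub>G\<^esub> x \<otimes>\<^bsub>G\<^esub> g)) =
    (\<Oplus>x\<in>F. f x \<otimes> h (inv\<^bsub>G\<^esub> x \<otimes>\<^bsub>G\<^esub> g) \<oplus> k x \<otimes> h (inv\<^bsub>G\<^esub> x \<otimes>\<^bsub>G\<^esub> g))"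
    by (rule finsum_cong') (use assms in \<open>auto simp: l_distr\<close>)
  ultimately have "((f \<oplus>\<^bsub>RG\<^esub> k) \<otimes>\<^bsub>RG\<^esub> h) g = (f \<otimes>\<^bsub>RG\<^esub> h) g \<oplus> (k \<otimes>\<^bsub>RG\<^esub> h) g"
    using RG_mult_eq_sum[OF RG_add_closed[OF assms(1,2)] assms(3) g F]
      RG_mult_eq_sum[OF assms(1,3) g F] RG_mult_eq_sum[OF assms(2,3) g F] assms
    by (simp add: RG_add finsum_addf Pi_def)
  then show "((f \<oplus>\<^bsub>RG\<^esub> k) \<otimes>\<^bsub>RG\<^esub> h) g = (f \<otimes>\<^bsub>RG\<^esub> h \<oplus>\<^bsub>RG\<^esub> k \<otimes>\<^bsub>RG\<^esub> h) g"
    by (simp only: RG_add[of "f \<otimes>\<^bsub>RG\<^esub> h"])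
qed (simp_all add: assms RG_mult_closed RG_add_closed)

lemma RG_r_distr:
  assumes "f \<in> carrier RG" "k \<in> carrier RG" "h \<in> carrier RG"
  shows "h \<otimes>\<^bsub>RG\<^esub> (f \<oplus>\<^bsub>RG\<^esub> k) = h \<otimes>\<^bsub>RG\<^esub> f \<oplus>\<^bsub>RG\<^esub> h \<otimes>\<^bsub>RG\<^esub> k"
proof (rule RG_eqI)
  fix g assume g: "g \<in> carrier G"
  define F where "F = {x. h x \<noteq> \<zero>}"
  have F: "finite F" "F \<subseteq> carrier G" using RG_finite_support[OF assms(3)] RG_support_subset[OF assms(3)] by (simp_all add: F_def)
  have "{x. h x \<noteq> \<zero>} \<subseteq> F" by (auto simp: F_def)
  moreover have "(\<Oplus>x\<in>F. h x \<otimes> (f (inv\<^bsub>G\<^esub> x \<otimes>\<^bsub>G\<^esub> g) \<oplus> k (inv\<^bsub>G\<^esub> x \<otimes>\<^bsub>G\<^esub> g))) =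
    (\<Oplus>x\<in>F. h x \<otimes> f (inv\<^bsub>G\<^esub> x \<otimes>\<^bsub>G\<^esub> g) \<oplus> h x \<otimes> k (inv\<^bsub>G\<^esub> x \<otimes>\<^bsub>G\<^esub> g))"
    by (rule finsum_cong') (use assms in \<open>auto simp: r_distr\<close>)
  ultimately have "(h \<otimes>\<^bsub>RG\<^esub> (f \<oplus>\<^bsub>RG\<^esub> k)) g = (h \<otimes>\<^bsub>RG\<^esub> f) g \<oplus> (h \<otimes>\<^bsub>RG\<^esub> k) g"
    using RG_mult_eq_sum[OF assms(3) RG_add_closed[OF assms(1,2)] g F]
      RG_mult_eq_sum[OF assms(3,1) g F] RG_mult_eq_sum[OF assms(3,2) g F] assms
    by (simp add: RG_add finsum_addf Pi_def)
  then show "(h \<otimes>\<^bsub>RG\<^esub> (f \<oplus>\<^bsub>RG\<^esub> k)) g = (h \<otimes>\<^bsub>RG\<^esub> f \<oplus>\<^bsub>RG\<^esub> h \<otimes>\<^bsub>RG\<^esub> k) g"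
    by (simp only: RG_add[of "h \<otimes>\<^bsub>RG\<^esub> f"])
qed (simp_all add: assms RG_mult_closed RG_add_closed)

text \<open>Left multiplication by a monomial shifts and scales coefficients, so for a monomial
  middle factor both sides can be compared coefficientwise; additivity does the rest.\<close>

lemma monomial_mult_assoc:
  assumes r: "r \<in> carrier R" "x \<in> carrier G" and h: "h \<in> carrier RG" and k: "k \<in> carrier RG"
  shows "monomial r x \<otimes>\<^bsub>RG\<^esub> h \<otimes>\<^bsub>RG\<^esub> k = monomial r x \<otimes>\<^bsub>RG\<^esub> (h \<otimes>\<^bsub>RG\<^esub> k)"
  using h
proof (induction h rule: RG_induct)
  case (monomial s y)
  show ?case
  proof (rule RG_eqI)
    fix g assume g: "g \<in> carrier G"
    show "(monomial r x \<otimes>\<^bsub>RG\<^esub> monomial s y \<otimes>\<^bsub>RG\<^esub> k) g = (monomial r x \<otimes>\<^bsub>RG\<^esub> (monomial s y \<otimes>\<^bsub>RG\<^esub> k)) g"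
      using g k r monomial
      by (simp add: monomial_mult_monomial monomial_mult RG_mult_closed m_assoc G.m_assoc G.inv_mult_group)
  qed (use assms monomial RG_mult_closed in auto)
next
  case (add f h)
  then show ?case using k r by (simp add: RG_l_distr RG_r_distr RG_mult_closed)
qed

lemma group_ring_is_ring: "ring RG"
proof (rule ringI)
  show "abelian_group RG"
  proof (rule abelian_groupI)
    fix f assume f: "f \<in> carrier RG"
    show "\<exists>h\<in>carrier RG. h \<oplus>\<^bsub>RG\<^esub> f = \<zero>\<^bsub>RG\<^esub>"
    proof (intro bexI[of _ "\<lambda>g. \<ominus> f g"])
      have "{g. \<ominus> f g \<noteq> \<zero>} \<subseteq> {g. f g \<noteq> \<zero>}" by auto
      then have "finite {g. \<ominus> f g \<noteq> \<zero>}" by (rule finite_subset) (rule RG_finite_support[OF f])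
      then show "(\<lambda>g. \<ominus> f g) \<in> carrier RG" using f by (simp add: carrier_RG_iff)
    qed (use f in \<open>auto simp: RG_add RG_zero l_neg\<close>)
  qed (simp_all add: RG_add_closed RG_zero_closed RG_zero, simp_all add: RG_add a_ac)
  show "monoid RG"
  proof (rule monoidI)
    fix f h k assume f: "f \<in> carrier RG" and hk: "h \<in> carrier RG" "k \<in> carrier RG"
    show "f \<otimes>\<^bsub>RG\<^esub> h \<otimes>\<^bsub>RG\<^esub> k = f \<otimes>\<^bsub>RG\<^esub> (h \<otimes>\<^bsub>RG\<^esub> k)"
      using f
    proof (induction f rule: RG_induct)
      case (monomial r x) then show ?case using hk monomial_mult_assoc by simp
    next
      case (add f f') then show ?case using hk by (simp add: RG_l_distr RG_mult_closed)
    qed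
  next
    fix f assume f: "f \<in> carrier RG"
    show "\<one>\<^bsub>RG\<^esub> \<otimes>\<^bsub>RG\<^esub> f = f"
      by (rule RG_eqI) (use f RG_mult_closed in \<open>auto simp: RG_one monomial_mult\<close>)
    show "f \<otimes>\<^bsub>RG\<^esub> \<one>\<^bsub>RG\<^esub> = f" using f
    proof (induction f rule: RG_induct)
      case (monomial r x) then show ?case by (simp add: RG_one monomial_mult_monomial)
    next
      case (add f f') then show ?case by (simp add: RG_one RG_l_distr)
    qed
  qed (auto simp: RG_mult_closed RG_one)
qed (rule RG_l_distr RG_r_distr; assumption)+

sublocale RG: ring "group_ring R G"
  by (rule group_ring_is_ring)

section \<open>Coefficients and group elements inside the group ring\<close>

lemma RG_finsum_apply:
  assumes "F \<in> A \<rightarrow> carrier RG"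
  shows "finsum RG F A g = (\<Oplus>i\<in>A. F i g)"
  using assms
proof (induction A rule: infinite_finite_induct)
  case (insert x A)
  then have "F \<in> A \<rightarrow> carrier RG" "F x \<in> carrier RG" by auto
  then show ?case using insert by (simp add: RG_add Pi_def)
qed (simp_all add: RG_zero)

text \<open>Each term is split into a coefficient times a group element, the shape needed to view
  the kernel as a span over the units \<open>monomial \<one> x\<close>.\<close>

lemma RG_eq_sum_monomials:
  assumes f: "f \<in> carrier RG" and fin: "finite (carrier G)"
  shows "f = (\<Oplus>\<^bsub>RG\<^esub>x\<in>carrier G. monomial (f x) \<one>\<^bsub>G\<^esub> \<otimes>\<^bsub>RG\<^esub> monomial \<one> x)"
proof (rule RG_eqI)
  fix g assume g: "g \<in> carrier G"
  have "(\<Oplus>\<^bsub>RG\<^esub>x\<in>carrier G. monomial (f x) \<one>\<^bsub>G\<^esub> \<otimes>\<^bsub>RG\<^esub> monomial \<one> x) g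
      = (\<Oplus>x\<in>carrier G. (monomial (f x) \<one>\<^bsub>G\<^esub> \<otimes>\<^bsub>RG\<^esub> monomial \<one> x) g)"
    by (rule RG_finsum_apply) (use f in auto)
  also have "\<dots> = (\<Oplus>x\<in>carrier G. if g = x then f x else \<zero>)"
    by (rule finsum_cong') (use f in \<open>auto simp: monomial_mult_monomial\<close>, auto simp: monomial_def)
  also have "\<dots> = f g" using g fin f by (intro finsum_singleton) auto
  finally show "f g = (\<Oplus>\<^bsub>RG\<^esub>x\<in>carrier G. monomial (f x) \<one>\<^bsub>G\<^esub> \<otimes>\<^bsub>RG\<^esub> monomial \<one> x) g" by simp
qed (use f in auto)

lemma monomial_one_Units: "x \<in> carrier G \<Longrightarrow> monomial \<one> x \<in> Units RG"
proof -
  assume x: "x \<in> carrier G"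
  have "monomial \<one> x \<otimes>\<^bsub>RG\<^esub> monomial \<one> (inv\<^bsub>G\<^esub> x) = \<one>\<^bsub>RG\<^esub>"
    "monomial \<one> (inv\<^bsub>G\<^esub> x) \<otimes>\<^bsub>RG\<^esub> monomial \<one> x = \<one>\<^bsub>RG\<^esub>"
    using x by (simp_all add: monomial_mult_monomial RG_one)
  then show ?thesis using x unfolding Units_def by fastforce
qed

text \<open>The embedding of \<open>R\<close> as multiples of the identity of \<open>G\<close> is
  multiplicative, so partial products are computed in \<open>R\<close>.\<close>

lemma T_nilpotent_coefficients:
  assumes A: "A \<subseteq> carrier R"
  shows "left_T_nilpotent R A \<Longrightarrow> left_T_nilpotent RG ((\<lambda>r. monomial r \<one>\<^bsub>G\<^esub>) ` A)" (is "_ \<Longrightarrow> ?L")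
    and "right_T_nilpotent R A \<Longrightarrow> right_T_nilpotent RG ((\<lambda>r. monomial r \<one>\<^bsub>G\<^esub>) ` A)" (is "_ \<Longrightarrow> ?R")
proof -
  have zero: "monomial \<zero> x = \<zero>\<^bsub>RG\<^esub>" for x by (auto simp: monomial_def RG_zero)
  have coeffs: "\<exists>a. range a \<subseteq> A \<and> c = (\<lambda>i. monomial (a i) \<one>\<^bsub>G\<^esub>)"
    if "range c \<subseteq> (\<lambda>r. monomial r \<one>\<^bsub>G\<^esub>) ` A" for c :: "nat \<Rightarrow> _"
  proof -
    have "\<forall>i. \<exists>r\<in>A. c i = monomial r \<one>\<^bsub>G\<^esub>" using that by blast
    then obtain a where "\<forall>i. a i \<in> A \<and> c i = monomial (a i) \<one>\<^bsub>G\<^esub>" by metis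
    then show ?thesis by (intro exI[of _ a]) auto
  qed
  have lr: "prod_lr R a n \<in> carrier R \<and> prod_lr RG (\<lambda>i. monomial (a i) \<one>\<^bsub>G\<^esub>) n = monomial (prod_lr R a n) \<one>\<^bsub>G\<^esub>"
    and rl: "prod_rl R a n \<in> carrier R \<and> prod_rl RG (\<lambda>i. monomial (a i) \<one>\<^bsub>G\<^esub>) n = monomial (prod_rl R a n) \<one>\<^bsub>G\<^esub>"
    if "range a \<subseteq> A" for a and n :: nat
  proof -
    have "a i \<in> carrier R" for i using that A by auto
    then show "prod_lr R a n \<in> carrier R \<and> prod_lr RG (\<lambda>i. monomial (a i) \<one>\<^bsub>G\<^esub>) n = monomial (prod_lr R a n) \<one>\<^bsub>G\<^esub>"
      "prod_rl R a n \<in> carrier R \<and> prod_rl RG (\<lambda>i. monomial (a i) \<one>\<^bsub>G\<^esub>) n = monomial (prod_rl R a n) \<one>\<^bsub>G\<^esub>"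
      by (induction n) (simp_all add: RG_one monomial_mult_monomial)
  qed
  show "left_T_nilpotent R A \<Longrightarrow> ?L"
    unfolding left_T_nilpotent_def using coeffs lr zero by metis
  show "right_T_nilpotent R A \<Longrightarrow> ?R"
    unfolding right_T_nilpotent_def using coeffs rl zero by metis
qed

end

section \<open>Change of the coefficient ring\<close>

locale group_ring_hom = ring_hom_ring R K \<phi> + G: group G
  for R :: "('r, 'n) ring_scheme" (structure) and K :: "('k, 'o) ring_scheme" and \<phi> and G :: "('g, 'm) monoid_scheme"
begin

sublocale R: group_ring_setup R G ..
sublocale K: group_ring_setup K G ..

lemma map_coeffs_closed:
  assumes f: "f \<in> carrier (group_ring R G)"
  shows "\<phi> \<circ> f \<in> carrier (group_ring K G)"
proof -
  have "{g. (\<phi> \<circ> f) g \<noteq> \<zero>\<^bsub>K\<^esub>} \<subseteq> {g. f g \<noteq> \<zero>}" by auto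
  then have "finite {g. (\<phi> \<circ> f) g \<noteq> \<zero>\<^bsub>K\<^esub>}" using f R.RG_finite_support by (metis finite_subset)
  then show ?thesis using f by (simp add: K.carrier_RG_iff R.RG_outside)
qed

lemma map_coeffs_ring_hom: "ring_hom_ring (group_ring R G) (group_ring K G) (\<lambda>f. \<phi> \<circ> f)"
proof (rule ring_hom_ringI2[OF R.group_ring_is_ring K.group_ring_is_ring], rule ring_hom_memI)
  fix f h assume f: "f \<in> carrier (group_ring R G)" and h: "h \<in> carrier (group_ring R G)"
  show "\<phi> \<circ> (f \<oplus>\<^bsub>group_ring R G\<^esub> h) = (\<phi> \<circ> f) \<oplus>\<^bsub>group_ring K G\<^esub> (\<phi> \<circ> h)"
    using f h by (simp add: R.RG_add K.RG_add fun_eq_iff)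
  show "\<phi> \<circ> (f \<otimes>\<^bsub>group_ring R G\<^esub> h) = (\<phi> \<circ> f) \<otimes>\<^bsub>group_ring K G\<^esub> (\<phi> \<circ> h)"
  proof (rule K.RG_eqI)
    fix g assume g: "g \<in> carrier G"
    \<comment> \<open>The support of \<open>f\<close> contains that of
      \<open>\<phi> \<circ> f\<close>, so both products are sums over the same set.\<close>
    define F where "F = {x. f x \<noteq> \<zero>}"
    have F: "finite F" "F \<subseteq> carrier G" using R.RG_finite_support[OF f] R.RG_support_subset[OF f] by (simp_all add: F_def)
    have 1: "{x. f x \<noteq> \<zero>} \<subseteq> F" "{x. (\<phi> \<circ> f) x \<noteq> \<zero>\<^bsub>K\<^esub>} \<subseteq> F" by (auto simp: F_def)
    have "(\<phi> \<circ> (f \<otimes>\<^bsub>group_ring R G\<^esub> h)) g = \<phi> (\<Oplus>x\<in>F. f x \<otimes> h (inv\<^bsub>G\<^esub> x \<otimes>\<^bsub>G\<^esub> g))"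
      using R.RG_mult_eq_sum[OF f h g F 1(1)] by simp
    also have "\<dots> = (\<Oplus>\<^bsub>K\<^esub>x\<in>F. (\<phi> \<circ> f) x \<otimes>\<^bsub>K\<^esub> (\<phi> \<circ> h) (inv\<^bsub>G\<^esub> x \<otimes>\<^bsub>G\<^esub> g))"
      using f h by (subst hom_finsum) (auto intro!: S.finsum_cong')
    also have "\<dots> = ((\<phi> \<circ> f) \<otimes>\<^bsub>group_ring K G\<^esub> (\<phi> \<circ> h)) g"
      by (rule K.RG_mult_eq_sum[OF map_coeffs_closed[OF f] map_coeffs_closed[OF h] g F 1(2), symmetric])
    finally show "(\<phi> \<circ> (f \<otimes>\<^bsub>group_ring R G\<^esub> h)) g = ((\<phi> \<circ> f) \<otimes>\<^bsub>group_ring K G\<^esub> (\<phi> \<circ> h)) g" .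
  qed (use f h map_coeffs_closed R.RG_mult_closed K.RG_mult_closed in auto)
next
  show "\<phi> \<circ> \<one>\<^bsub>group_ring R G\<^esub> = \<one>\<^bsub>group_ring K G\<^esub>"
    by (auto simp: R.RG_one K.RG_one R.monomial_def K.monomial_def)
qed (rule map_coeffs_closed)

lemma map_coeffs_surj:
  assumes surj: "\<phi> ` carrier R = carrier K"
  shows "(\<lambda>f. \<phi> \<circ> f) ` carrier (group_ring R G) = carrier (group_ring K G)"
proof (intro equalityI subsetI)
  fix k assume k: "k \<in> carrier (group_ring K G)"
  \<comment> \<open>Zero coefficients are lifted to zero; otherwise the chosen lift could have
    infinite support.\<close>
  have "\<forall>g. \<exists>r\<in>carrier R. \<phi> r = k g \<and> (k g = \<zero>\<^bsub>K\<^esub> \<longrightarrow> r = \<zero>)"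
  proof
    fix g
    obtain r where "r \<in> carrier R" "\<phi> r = k g" using surj k by (metis K.RG_coeff_closed imageE)
    then show "\<exists>r\<in>carrier R. \<phi> r = k g \<and> (k g = \<zero>\<^bsub>K\<^esub> \<longrightarrow> r = \<zero>)"
      by (cases "k g = \<zero>\<^bsub>K\<^esub>") auto
  qed
  then obtain f where f: "\<And>g. f g \<in> carrier R" "\<And>g. \<phi> (f g) = k g" "\<And>g. k g = \<zero>\<^bsub>K\<^esub> \<Longrightarrow> f g = \<zero>" by metis
  have "{g. f g \<noteq> \<zero>} \<subseteq> {g. k g \<noteq> \<zero>\<^bsub>K\<^esub>}" using f by auto
  then have "finite {g. f g \<noteq> \<zero>}" using K.RG_finite_support[OF k] by (rule finite_subset)
  then have "f \<in> carrier (group_ring R G)" using f K.RG_outside[OF k] by (simp add: R.carrier_RG_iff)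
  moreover have "\<phi> \<circ> f = k" using f by auto
  ultimately show "k \<in> (\<lambda>f. \<phi> \<circ> f) ` carrier (group_ring R G)" by blast
qed (use map_coeffs_closed in auto)

end

section \<open>Group rings over semisimple rings\<close>

context group_ring_setup
begin

text \<open>Echelon form: with the finite group enumerated by \<open>\<epsilon>\<close>, a left
  ideal of the group ring is a submodule of a free module of finite rank, filtered by vanishing of
  initial coordinates. These sets describe its successive quotients inside \<open>R\<close>.\<close>

definition leading_coeffs :: "(nat \<Rightarrow> 'g) \<Rightarrow> ('g \<Rightarrow> 'r) set \<Rightarrow> nat \<Rightarrow> 'r set" where
  "leading_coeffs \<epsilon> N i = {f (\<epsilon> i) | f. f \<in> N \<and> (\<forall>j<i. f (\<epsilon> j) = \<zero>)}"

lemma leading_coeffsI: "f \<in> N \<Longrightarrow> (\<And>j. j < i \<Longrightarrow> f (\<epsilon> j) = \<zero>) \<Longrightarrow> f (\<epsilon> i) \<in> leading_coeffs \<epsilon> N i"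
  unfolding leading_coeffs_def by blast

lemma leading_coeffsE:
  assumes "x \<in> leading_coeffs \<epsilon> N i"
  obtains f where "f \<in> N" "\<And>j. j < i \<Longrightarrow> f (\<epsilon> j) = \<zero>" "x = f (\<epsilon> i)"
  using assms unfolding leading_coeffs_def by blast

lemma leading_coeffs_mono: "N \<subseteq> N' \<Longrightarrow> leading_coeffs \<epsilon> N i \<subseteq> leading_coeffs \<epsilon> N' i"
  unfolding leading_coeffs_def by blast

lemma leading_coeffs_left_ideal:
  assumes N: "left_ideal N RG" and \<epsilon>: "\<And>j. j \<le> i \<Longrightarrow> \<epsilon> j \<in> carrier G"
  shows "left_ideal (leading_coeffs \<epsilon> N i) R"
proof -
  interpret N: left_ideal N RG by (rule N)
  show ?thesis
  proof (rule left_idealI)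
    show "leading_coeffs \<epsilon> N i \<subseteq> carrier R"
    proof
      fix x assume "x \<in> leading_coeffs \<epsilon> N i"
      then obtain f where "f \<in> N" "x = f (\<epsilon> i)" by (rule leading_coeffsE)
      then show "x \<in> carrier R" using RG_coeff_closed[OF N.subset_carrier] by simp
    qed
    have "(\<lambda>g. \<zero>) \<in> N" using N.zero_closed by (simp only: RG_zero)
    then show "\<zero> \<in> leading_coeffs \<epsilon> N i" using leading_coeffsI[of "\<lambda>g. \<zero>" N i \<epsilon>] by simp
  next
    fix x y assume "x \<in> leading_coeffs \<epsilon> N i" "y \<in> leading_coeffs \<epsilon> N i"
    then obtain f h where fh: "f \<in> N" "h \<in> N" "x = f (\<epsilon> i)" "y = h (\<epsilon> i)"
      "\<And>j. j < i \<Longrightarrow> f (\<epsilon> j) = \<zero>" "\<And>j. j < i \<Longrightarrow> h (\<epsilon> j) = \<zero>" by (elim leading_coeffsE) blast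
    then have "f \<oplus>\<^bsub>RG\<^esub> h \<in> N" by simp
    then have "(f \<oplus>\<^bsub>RG\<^esub> h) (\<epsilon> i) \<in> leading_coeffs \<epsilon> N i"
      by (rule leading_coeffsI) (simp add: RG_add fh)
    then show "x \<oplus> y \<in> leading_coeffs \<epsilon> N i" by (simp add: RG_add fh)
  next
    fix x r assume "x \<in> leading_coeffs \<epsilon> N i" and r: "r \<in> carrier R"
    then obtain f where f: "f \<in> N" "x = f (\<epsilon> i)" "\<And>j. j < i \<Longrightarrow> f (\<epsilon> j) = \<zero>" by (elim leading_coeffsE) blast
    have fc: "f \<in> carrier RG" by (rule N.subset_carrier[OF f(1)])
    have "monomial r \<one>\<^bsub>G\<^esub> \<otimes>\<^bsub>RG\<^esub> f \<in> N" using f r N.I_l_closed by simp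
    then have "(monomial r \<one>\<^bsub>G\<^esub> \<otimes>\<^bsub>RG\<^esub> f) (\<epsilon> i) \<in> leading_coeffs \<epsilon> N i"
      by (rule leading_coeffsI) (simp add: monomial_mult \<epsilon> fc r f)
    then show "r \<otimes> x \<in> leading_coeffs \<epsilon> N i" by (simp add: monomial_mult \<epsilon> fc r f)
  qed (rule ring_axioms)
qed

text \<open>Elimination: from an element of \<open>N'\<close> subtract one of \<open>N\<close> with
  the same leading coefficient, gaining one more vanishing coordinate. The induction descends from
  \<open>n\<close>, where all coordinates vanish.\<close>

lemma eq_of_leading_coeffs_eq:
  assumes N: "left_ideal N RG" and N': "left_ideal N' RG" and sub: "N \<subseteq> N'"
    and \<epsilon>: "carrier G \<subseteq> \<epsilon> ` {..<n}"
    and eq: "\<And>i. i < n \<Longrightarrow> leading_coeffs \<epsilon> N i = leading_coeffs \<epsilon> N' i"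
  shows "N = N'"
proof -
  interpret N: left_ideal N RG by (rule N)
  interpret N': left_ideal N' RG by (rule N')
  have "f \<in> N" if "i \<le> n" "f \<in> N'" "\<And>j. j < i \<Longrightarrow> f (\<epsilon> j) = \<zero>" for i f
    using that
  proof (induction i arbitrary: f rule: inc_induct)
    case base
    have "f = (\<lambda>g. \<zero>)"
    proof (rule RG_eqI)
      fix g assume "g \<in> carrier G"
      then obtain j where "j < n" "g = \<epsilon> j" using \<epsilon> by auto
      then show "f g = \<zero>" using base by simp
    qed (use N'.subset_carrier base RG_zero_closed in auto)
    then show ?case using N.zero_closed by (simp add: RG_zero)
  next
    case (step i)
    have "f (\<epsilon> i) \<in> leading_coeffs \<epsilon> N' i" using step.prems by (intro leading_coeffsI)
    then have "f (\<epsilon> i) \<in> leading_coeffs \<epsilon> N i" using eq[OF step.hyps(2)] by simp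
    then obtain h where h: "h \<in> N" "f (\<epsilon> i) = h (\<epsilon> i)" "\<And>j. j < i \<Longrightarrow> h (\<epsilon> j) = \<zero>"
      by (elim leading_coeffsE) blast
    have c: "f \<in> carrier RG" "h \<in> carrier RG"
      by (rule N'.subset_carrier[OF step.prems(1)], rule N.subset_carrier[OF h(1)])
    define d where "d = f \<ominus>\<^bsub>RG\<^esub> h"
    have d: "d \<in> N'" unfolding d_def using step.prems(1) h(1) sub N'.minus_closed_ideal by blast
    have dc: "d \<in> carrier RG" by (rule N'.subset_carrier[OF d])
    have f: "f = h \<oplus>\<^bsub>RG\<^esub> d"
      using c by (simp add: d_def RG.minus_eq RG.a_comm[of h] RG.a_assoc RG.l_neg)
    have sum: "f g = h g \<oplus> d g" for g using fun_cong[OF f, of g] by (simp only: RG_add)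
    have dz: "d (\<epsilon> j) = \<zero>" if "j < Suc i" for j
    proof -
      have "f (\<epsilon> j) = h (\<epsilon> j)" using that h step.prems(2) by (metis less_antisym)
      then show ?thesis using sum[of "\<epsilon> j"] c dc by simp
    qed
    have "d \<in> N" by (rule step.IH[OF d dz])
    then show ?case using h(1) by (subst f) simp
  qed
  from this[of 0] show ?thesis using sub by auto
qed

text \<open>For each of the finitely many positions the leading coefficients form a chain of left
  ideals of \<open>R\<close>, which becomes stationary. Beyond the largest of these stages the left
  ideals themselves agree.\<close>

lemma semisimple_group_ring_chain:
  assumes ss: "semisimple_ring R" and fin: "finite (carrier G)"
    and N: "\<And>k. left_ideal (N k) RG"
    and mono: "(\<forall>k. N k \<subseteq> N (Suc k)) \<or> (\<forall>k. N (Suc k) \<subseteq> N k)"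
  shows "\<exists>m. \<forall>k\<ge>m. N k = N m"
proof -
  obtain n \<epsilon> where "bij_betw \<epsilon> {..<n::nat} (carrier G)"
    using fin ex_bij_betw_nat_finite[OF fin] by (auto simp: atLeast0LessThan)
  then have \<epsilon>: "\<epsilon> ` {..<n} = carrier G" by (simp add: bij_betw_def)
  have L: "left_ideal (leading_coeffs \<epsilon> (N k) i) R" if "i < n" for i k
    by (rule leading_coeffs_left_ideal[OF N]) (use \<epsilon> that in auto)
  have "\<exists>m. \<forall>k\<ge>m. leading_coeffs \<epsilon> (N k) i = leading_coeffs \<epsilon> (N m) i" if i: "i < n" for i
    using mono
  proof
    assume "\<forall>k. N k \<subseteq> N (Suc k)"
    then show ?thesis by (intro semisimple_ascending_chain[OF ss L[OF i]] leading_coeffs_mono) auto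
  next
    assume "\<forall>k. N (Suc k) \<subseteq> N k"
    then show ?thesis by (intro semisimple_descending_chain[OF ss L[OF i]] leading_coeffs_mono) auto
  qed
  then obtain m where m: "\<And>i k. i < n \<Longrightarrow> k \<ge> m i \<Longrightarrow> leading_coeffs \<epsilon> (N k) i = leading_coeffs \<epsilon> (N (m i)) i"
    by metis
  define M where "M = Max (insert 0 (m ` {..<n}))"
  have M: "m i \<le> M" if "i < n" for i unfolding M_def using that by (intro Max_ge) auto
  have eq: "leading_coeffs \<epsilon> (N k) i = leading_coeffs \<epsilon> (N M) i" if "i < n" "k \<ge> M" for i k
    using m[of i k] m[of i M] M[of i] that by simp
  have "N k = N M" if k: "k \<ge> M" for k
    using mono
  proof
    assume "\<forall>k. N k \<subseteq> N (Suc k)"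
    then have "N M \<subseteq> N k" using k lift_Suc_mono_le[of N M k] by blast
    then show ?thesis using eq_of_leading_coeffs_eq[OF N N, of M k \<epsilon> n] eq[OF _ k] \<epsilon> by simp
  next
    assume "\<forall>k. N (Suc k) \<subseteq> N k"
    then have "N k \<subseteq> N M" using k lift_Suc_antimono_le[of N M k] by blast
    then show ?thesis using eq_of_leading_coeffs_eq[OF N N, of k M \<epsilon> n] eq[OF _ k] \<epsilon> by simp
  qed
  then show ?thesis by blast
qed

text \<open>Fitting's lemma for the endomorphism \<open>x \<mapsto> x a\<close> of the left module \<open>RG\<close>: the images and the
  kernels of its powers become stationary.\<close>

lemma semisimple_group_ring_strongly_pi_regular:
  assumes ss: "semisimple_ring R" and fin: "finite (carrier G)" and a: "a \<in> carrier RG"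
  shows "strongly_pi_regular_elem RG a"
proof -
  note [simp] = a
  define L where "L k = {x \<otimes>\<^bsub>RG\<^esub> a [^]\<^bsub>RG\<^esub> k | x. x \<in> carrier RG}" for k :: nat
  define K where "K k = {x \<in> carrier RG. x \<otimes>\<^bsub>RG\<^esub> a [^]\<^bsub>RG\<^esub> k = \<zero>\<^bsub>RG\<^esub>}" for k :: nat
  have LI: "x \<otimes>\<^bsub>RG\<^esub> a [^]\<^bsub>RG\<^esub> k \<in> L k" if "x \<in> carrier RG" for x k using that unfolding L_def by blast
  have "\<exists>m. \<forall>k\<ge>m. L k = L m"
  proof (rule semisimple_group_ring_chain[OF ss fin])
    show "left_ideal (L k) RG" for k
    proof (rule left_idealI)
      show "\<zero>\<^bsub>RG\<^esub> \<in> L k" using LI[of "\<zero>\<^bsub>RG\<^esub>" k] by simp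
    next
      fix x y assume "x \<in> L k" "y \<in> L k"
      then obtain p q where "p \<in> carrier RG" "q \<in> carrier RG" "x = p \<otimes>\<^bsub>RG\<^esub> a [^]\<^bsub>RG\<^esub> k" "y = q \<otimes>\<^bsub>RG\<^esub> a [^]\<^bsub>RG\<^esub> k"
        unfolding L_def by blast
      then show "x \<oplus>\<^bsub>RG\<^esub> y \<in> L k" using LI[of "p \<oplus>\<^bsub>RG\<^esub> q" k] by (simp add: RG.l_distr)
    next
      fix x r assume "x \<in> L k" and r: "r \<in> carrier RG"
      then obtain p where "p \<in> carrier RG" "x = p \<otimes>\<^bsub>RG\<^esub> a [^]\<^bsub>RG\<^esub> k" unfolding L_def by blast
      then show "r \<otimes>\<^bsub>RG\<^esub> x \<in> L k" using LI[of "r \<otimes>\<^bsub>RG\<^esub> p" k] r by (simp add: RG.m_assoc)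
    qed (auto simp: L_def RG.ring_axioms)
    have "L (Suc k) \<subseteq> L k" for k
    proof
      fix y assume "y \<in> L (Suc k)"
      then obtain x where x: "x \<in> carrier RG" "y = x \<otimes>\<^bsub>RG\<^esub> a [^]\<^bsub>RG\<^esub> Suc k" unfolding L_def by blast
      have "a [^]\<^bsub>RG\<^esub> Suc k = a \<otimes>\<^bsub>RG\<^esub> a [^]\<^bsub>RG\<^esub> k" using RG.pow_commute[of a a k] by simp
      then have "y = x \<otimes>\<^bsub>RG\<^esub> a \<otimes>\<^bsub>RG\<^esub> a [^]\<^bsub>RG\<^esub> k" using x by (simp add: RG.m_assoc)
      then show "y \<in> L k" using LI[of "x \<otimes>\<^bsub>RG\<^esub> a" k] x by simp
    qed
    then show "(\<forall>k. L k \<subseteq> L (Suc k)) \<or> (\<forall>k. L (Suc k) \<subseteq> L k)" by blast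
  qed
  then obtain m1 where m1: "\<And>k. k \<ge> m1 \<Longrightarrow> L k = L m1" by blast
  have "\<exists>m. \<forall>k\<ge>m. K k = K m"
  proof (rule semisimple_group_ring_chain[OF ss fin])
    show "left_ideal (K k) RG" for k
      by (rule left_idealI) (auto simp: K_def RG.ring_axioms RG.l_distr RG.m_assoc)
    have "K k \<subseteq> K (Suc k)" for k
      by (auto simp: K_def RG.m_assoc[symmetric])
    then show "(\<forall>k. K k \<subseteq> K (Suc k)) \<or> (\<forall>k. K (Suc k) \<subseteq> K k)" by blast
  qed
  then obtain m2 where m2: "\<And>k. k \<ge> m2 \<Longrightarrow> K k = K m2" by blast
  \<comment> \<open>Both chains are constant from here on, and the successor makes the exponent
    positive.\<close>
  define n where "n = Suc (max m1 m2)"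
  have n: "1 \<le> n" by (simp add: n_def)
  define \<alpha> where "\<alpha> = a [^]\<^bsub>RG\<^esub> n"
  have \<alpha>[simp]: "\<alpha> \<in> carrier RG" by (simp add: \<alpha>_def)
  have \<alpha>\<alpha>: "a [^]\<^bsub>RG\<^esub> (n + n) = \<alpha> \<otimes>\<^bsub>RG\<^esub> \<alpha>" by (simp add: \<alpha>_def RG.nat_pow_mult)
  have "\<alpha> \<in> L n" using LI[of "\<one>\<^bsub>RG\<^esub>" n] by (simp add: \<alpha>_def)
  also have "L n = L (n + n)" using m1[of n] m1[of "n + n"] by (simp add: n_def)
  finally obtain y where y[simp]: "y \<in> carrier RG" and "\<alpha> = y \<otimes>\<^bsub>RG\<^esub> a [^]\<^bsub>RG\<^esub> (n + n)"
    unfolding L_def by blast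
  then have y\<alpha>: "y \<otimes>\<^bsub>RG\<^esub> (\<alpha> \<otimes>\<^bsub>RG\<^esub> \<alpha>) = \<alpha>" by (simp only: \<alpha>\<alpha>)
  have "K n = K (n + n)" using m2[of n] m2[of "n + n"] by (simp add: n_def)
  then have ker: "x \<otimes>\<^bsub>RG\<^esub> \<alpha> = \<zero>\<^bsub>RG\<^esub>" if "x \<in> carrier RG" "x \<otimes>\<^bsub>RG\<^esub> (\<alpha> \<otimes>\<^bsub>RG\<^esub> \<alpha>) = \<zero>\<^bsub>RG\<^esub>" for x
    using that by (auto simp: K_def \<alpha>\<alpha> \<alpha>_def[symmetric])
  \<comment> \<open>Equality of the kernels of \<open>\<alpha>\<close> and its square allows one
    factor \<open>\<alpha>\<close> to be cancelled on the right.\<close>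
  have canc: "p \<otimes>\<^bsub>RG\<^esub> \<alpha> = q \<otimes>\<^bsub>RG\<^esub> \<alpha>"
    if pq: "p \<in> carrier RG" "q \<in> carrier RG" "p \<otimes>\<^bsub>RG\<^esub> (\<alpha> \<otimes>\<^bsub>RG\<^esub> \<alpha>) = q \<otimes>\<^bsub>RG\<^esub> (\<alpha> \<otimes>\<^bsub>RG\<^esub> \<alpha>)" for p q
  proof -
    have *: "(p \<ominus>\<^bsub>RG\<^esub> q) \<otimes>\<^bsub>RG\<^esub> z = p \<otimes>\<^bsub>RG\<^esub> z \<ominus>\<^bsub>RG\<^esub> q \<otimes>\<^bsub>RG\<^esub> z" if "z \<in> carrier RG" for z
      using pq(1,2) that by (simp add: RG.minus_eq RG.l_distr RG.l_minus)
    have "(p \<ominus>\<^bsub>RG\<^esub> q) \<otimes>\<^bsub>RG\<^esub> \<alpha> = \<zero>\<^bsub>RG\<^esub>" by (rule ker) (use pq in \<open>auto simp: *\<close>)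
    then show ?thesis using pq by (simp add: *)
  qed
  \<comment> \<open>Stationary images give only the left witness \<open>y\<close>. Two cancellations
    yield \<open>\<alpha> y \<alpha> = \<alpha>\<close> and
    \<open>\<alpha> y y \<alpha> = y \<alpha>\<close>, so that \<open>y y \<alpha>\<close> is a
    right witness.\<close>
  have \<alpha>y: "\<alpha> \<otimes>\<^bsub>RG\<^esub> y \<otimes>\<^bsub>RG\<^esub> \<alpha> = \<one>\<^bsub>RG\<^esub> \<otimes>\<^bsub>RG\<^esub> \<alpha>"
    by (rule canc) (simp_all add: RG.m_assoc y\<alpha>)
  have "\<alpha> \<otimes>\<^bsub>RG\<^esub> y \<otimes>\<^bsub>RG\<^esub> y \<otimes>\<^bsub>RG\<^esub> \<alpha> = y \<otimes>\<^bsub>RG\<^esub> \<alpha>"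
    by (rule canc) (use \<alpha>y in \<open>simp_all add: RG.m_assoc y\<alpha>\<close>)
  then have "\<alpha> \<otimes>\<^bsub>RG\<^esub> (\<alpha> \<otimes>\<^bsub>RG\<^esub> y \<otimes>\<^bsub>RG\<^esub> y \<otimes>\<^bsub>RG\<^esub> \<alpha>) = \<alpha>" using \<alpha>y by (simp add: RG.m_assoc)
  then have "\<alpha> \<otimes>\<^bsub>RG\<^esub> \<alpha> \<otimes>\<^bsub>RG\<^esub> (y \<otimes>\<^bsub>RG\<^esub> y \<otimes>\<^bsub>RG\<^esub> \<alpha>) = \<alpha>" by (simp add: RG.m_assoc)
  then show ?thesis unfolding strongly_pi_regular_elem_def
    using y\<alpha>
    by - (rule exI[of _ n], rule conjI[OF n], rule bexI[of _ y],
      rule bexI[of _ "y \<otimes>\<^bsub>RG\<^esub> y \<otimes>\<^bsub>RG\<^esub> \<alpha>"], simp_all flip: \<alpha>_def)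
qed

end

section \<open>Group rings over perfect rings\<close>

text \<open>For a maximal left ideal \<open>M\<close> and \<open>r \<notin> M\<close>, the left ideal \<open>{x. x r \<in> M}\<close> is again maximal.\<close>

lemma jacobson_radical_ideal:
  fixes R (structure)
  assumes "ring R"
  shows "ideal (jacobson_radical R) R"
proof -
  interpret ring R by fact
  define J where "J = jacobson_radical R"
  have J: "x \<in> J \<longleftrightarrow> x \<in> carrier R \<and> (\<forall>M. maximal_left_ideal M R \<longrightarrow> x \<in> M)" for x
    by (simp add: J_def jacobson_radical_def)
  have lc: "r \<otimes> x \<in> J" if "x \<in> J" "r \<in> carrier R" for x r
    using that left_ideal.I_l_closed by (fastforce simp: J maximal_left_ideal_def)
  have rc: "x \<otimes> r \<in> J" if x: "x \<in> J" and r: "r \<in> carrier R" for x r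
    unfolding J
  proof (intro conjI allI impI)
    note [simp] = r
    show "x \<otimes> r \<in> carrier R" using x by (simp add: J)
    fix M assume M: "maximal_left_ideal M R"
    interpret M: left_ideal M R using M by (simp add: maximal_left_ideal_def)
    define N where "N = {y \<in> carrier R. y \<otimes> r \<in> M}"
    have N: "left_ideal N R"
      by (rule left_idealI) (auto simp: N_def l_distr m_assoc M.I_l_closed ring_axioms)
    show "x \<otimes> r \<in> M"
    proof (cases "N = carrier R")
      case True
      then show ?thesis using x by (auto simp: N_def J)
    next
      case False
      have "maximal_left_ideal N R" unfolding maximal_left_ideal_def
      proof (intro conjI allI impI)
        fix P assume P: "left_ideal P R \<and> N \<subseteq> P"
        interpret P: left_ideal P R using P by blast
        show "P = N \<or> P = carrier R"
        proof (cases "P \<subseteq> N")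
          case False
          then obtain y where y: "y \<in> P" "y \<notin> N" by blast
          then have yc[simp]: "y \<in> carrier R" using P.subset_carrier by blast
          then have yr: "y \<otimes> r \<notin> M" using y by (simp add: N_def)
          \<comment> \<open>This is \<open>M + R y r\<close>, which properly contains
            \<open>M\<close> and so is everything. Writing \<open>r = m + s y r\<close> shows that
            \<open>1 - s y\<close> lies in \<open>N\<close>, hence in \<open>P\<close>; as
            \<open>s y\<close> lies in \<open>P\<close> too, \<open>P\<close> contains 1.\<close>
          define Q where "Q = {m \<oplus> s \<otimes> (y \<otimes> r) | m s. m \<in> M \<and> s \<in> carrier R}"
          have QI: "m \<oplus> s \<otimes> (y \<otimes> r) \<in> Q" if "m \<in> M" "s \<in> carrier R" for m s using that by (auto simp: Q_def)
          have "left_ideal Q R"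
          proof (rule left_idealI)
            show "Q \<subseteq> carrier R" using M.subset_carrier by (auto simp: Q_def)
            show "\<zero> \<in> Q" using QI[OF M.zero_closed zero_closed] by simp
          next
            fix p q assume "p \<in> Q" "q \<in> Q"
            then obtain m s m' s' where *: "m \<in> M" "m' \<in> M" "s \<in> carrier R" "s' \<in> carrier R"
              "p = m \<oplus> s \<otimes> (y \<otimes> r)" "q = m' \<oplus> s' \<otimes> (y \<otimes> r)" unfolding Q_def by blast
            then have "p \<oplus> q = (m \<oplus> m') \<oplus> (s \<oplus> s') \<otimes> (y \<otimes> r)"
              using M.subset_carrier by (simp add: l_distr a_ac)
            then show "p \<oplus> q \<in> Q" using QI * by simp
          next
            fix p t assume "p \<in> Q" and t: "t \<in> carrier R"
            then obtain m s where *: "m \<in> M" "s \<in> carrier R" "p = m \<oplus> s \<otimes> (y \<otimes> r)" unfolding Q_def by blast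
            then have "t \<otimes> p = t \<otimes> m \<oplus> (t \<otimes> s) \<otimes> (y \<otimes> r)"
              using M.subset_carrier t by (simp add: r_distr m_assoc)
            then show "t \<otimes> p \<in> Q" using QI * t M.I_l_closed by simp
          qed (rule ring_axioms)
          moreover have "M \<subseteq> Q"
          proof
            fix m assume m: "m \<in> M"
            show "m \<in> Q" using QI[OF m zero_closed] M.subset_carrier[OF m] by simp
          qed
          moreover have "y \<otimes> r \<in> Q" using QI[OF M.zero_closed one_closed] by simp
          ultimately have "Q = carrier R" using M yr unfolding maximal_left_ideal_def by metis
          then have "r \<in> Q" by simp
          then obtain m s where ms: "m \<in> M" "s \<in> carrier R" "r = m \<oplus> s \<otimes> (y \<otimes> r)" unfolding Q_def by blast
          have mc: "m \<in> carrier R" using ms M.subset_carrier by blast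
          have "(\<one> \<ominus> s \<otimes> y) \<otimes> r = r \<ominus> s \<otimes> (y \<otimes> r)"
            using ms(2) by (simp add: minus_eq l_distr l_minus m_assoc)
          also have "\<dots> = m"
            using ms(2) mc by (subst ms(3)) (simp add: minus_eq a_assoc r_neg)
          finally have "\<one> \<ominus> s \<otimes> y \<in> P" using ms P by (auto simp: N_def)
          moreover have "s \<otimes> y \<in> P" using P.I_l_closed y ms by blast
          ultimately have "(\<one> \<ominus> s \<otimes> y) \<oplus> s \<otimes> y \<in> P" by (rule P.a_closed)
          moreover have "(\<one> \<ominus> s \<otimes> y) \<oplus> s \<otimes> y = \<one>" using ms(2) by (simp add: minus_eq a_assoc l_neg)
          ultimately have "\<one> \<in> P" by simp
          have "z \<in> P" if "z \<in> carrier R" for z using P.I_l_closed[OF \<open>\<one> \<in> P\<close> that] that by simp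
          then show ?thesis using P.subset_carrier by blast
        qed (use P in blast)
      qed (use N False in auto)
      then have "x \<in> N" using x by (auto simp: J)
      then show ?thesis by (simp add: N_def)
    qed
  qed
  have "left_ideal J R"
  proof (rule left_idealI)
    show "\<zero> \<in> J" by (auto simp: J maximal_left_ideal_def left_ideal_def additive_subgroup.zero_closed)
    show "x \<oplus> y \<in> J" if "x \<in> J" "y \<in> J" for x y
      using that by (auto simp: J maximal_left_ideal_def left_ideal_def intro: additive_subgroup.a_closed)
  qed (use lc J ring_axioms in auto)
  then have "additive_subgroup J R" by (simp add: left_ideal_def)
  then show ?thesis unfolding J_def[symmetric]
    by (intro ideal.intro ideal_axioms.intro ring_axioms) (use lc rc in auto)
qed

text \<open>Coefficients are reduced modulo the radical \<open>J\<close>, where Fitting's lemma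
  applies. An element of the kernel has its coefficients in \<open>J\<close>, so it is a combination
  of group elements, which are units commuting with the embedded coefficients.\<close>

lemma perfect_group_ring_strongly_pi_regular:
  fixes R :: "('r, 'n) ring_scheme" and G :: "('g, 'm) monoid_scheme"
  assumes perf: "right_perfect_ring R \<or> left_perfect_ring R" and G: "group G" and fin: "finite (carrier G)"
    and a: "a \<in> carrier (group_ring R G)"
  shows "strongly_pi_regular_elem (group_ring R G) a"
proof -
  define J where "J = jacobson_radical R"
  have R: "ring R" and ss: "semisimple_ring (R Quot J)" and T: "left_T_nilpotent R J \<or> right_T_nilpotent R J"
    using perf by (auto simp: right_perfect_ring_def left_perfect_ring_def J_def)
  interpret R: ring R by (rule R)
  interpret J: ideal J R unfolding J_def by (rule jacobson_radical_ideal[OF R])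
  interpret GH: group_ring_hom R "R Quot J" "(+>\<^bsub>R\<^esub>) J" G
    by (intro group_ring_hom.intro J.rcos_ring_hom_ring G)
  interpret h: ring_hom_ring "group_ring R G" "group_ring (R Quot J) G" "\<lambda>f. (+>\<^bsub>R\<^esub>) J \<circ> f"
    by (rule GH.map_coeffs_ring_hom)
  have surj: "(+>\<^bsub>R\<^esub>) J ` carrier R = carrier (R Quot J)"
    by (simp only: FactRing_def A_RCOSETS_def' partial_object.select_convs) blast
  let ?A = "(\<lambda>r. GH.R.monomial r \<one>\<^bsub>G\<^esub>) ` J"
  show ?thesis
  proof (rule h.strongly_pi_regular_lift_span[OF GH.map_coeffs_surj[OF surj], where A="?A" and H="carrier G" and \<delta>="GH.R.monomial \<one>\<^bsub>R\<^esub>"])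
    show "left_T_nilpotent (group_ring R G) ?A \<or> right_T_nilpotent (group_ring R G) ?A"
      using T GH.R.T_nilpotent_coefficients[OF J.a_subset] by blast
    show "?A \<subseteq> carrier (group_ring R G)" using J.a_subset by auto
    show "r \<otimes>\<^bsub>group_ring R G\<^esub> GH.R.monomial \<one>\<^bsub>R\<^esub> i = GH.R.monomial \<one>\<^bsub>R\<^esub> i \<otimes>\<^bsub>group_ring R G\<^esub> r"
      if "i \<in> carrier G" "r \<in> ?A" for i r
      using that J.a_subset by (auto simp: GH.R.monomial_mult_monomial subset_iff)
    show "\<exists>r. (\<forall>i\<in>carrier G. r i \<in> ?A) \<and>
        x = (\<Oplus>\<^bsub>group_ring R G\<^esub>i\<in>carrier G. r i \<otimes>\<^bsub>group_ring R G\<^esub> GH.R.monomial \<one>\<^bsub>R\<^esub> i)"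
      if x: "x \<in> carrier (group_ring R G)" and hx: "(+>\<^bsub>R\<^esub>) J \<circ> x = \<zero>\<^bsub>group_ring (R Quot J) G\<^esub>" for x
    proof (intro exI conjI ballI)
      show "x = (\<Oplus>\<^bsub>group_ring R G\<^esub>i\<in>carrier G. GH.R.monomial (x i) \<one>\<^bsub>G\<^esub> \<otimes>\<^bsub>group_ring R G\<^esub> GH.R.monomial \<one>\<^bsub>R\<^esub> i)"
        by (rule GH.R.RG_eq_sum_monomials[OF x fin])
      fix i
      have "\<zero>\<^bsub>R Quot J\<^esub> = J" by (simp only: FactRing_def ring.select_convs)
      then have "J +>\<^bsub>R\<^esub> x i = J" using fun_cong[OF hx, of i] by (simp only: GH.K.RG_zero o_apply)
      then have "x i \<in> J" using J.a_rcos_self[OF GH.R.RG_coeff_closed[OF x, of i]] by simp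
      then show "GH.R.monomial (x i) \<one>\<^bsub>G\<^esub> \<in> ?A" by blast
    qed
    show "strongly_pi_regular_elem (group_ring (R Quot J) G) ((+>\<^bsub>R\<^esub>) J \<circ> a)"
      using GH.K.semisimple_group_ring_strongly_pi_regular[OF ss fin] GH.map_coeffs_closed[OF a] by blast
  qed (use fin a GH.R.monomial_one_Units in auto)
qed

theorem corollary4p17:
  fixes R :: "('r, 'n) ring_scheme" and G :: "('g, 'm) monoid_scheme"
  assumes "right_perfect_ring R \<or> left_perfect_ring R"
    and "locally_finite_group G"
  shows "strongly_unit_nil_clean_ring (group_ring R G)"
proof -
  have "ring R" using assms(1) by (auto simp: right_perfect_ring_def left_perfect_ring_def)
  moreover have "group G" using assms(2) by (simp add: locally_finite_group_def)
  ultimately interpret group_ring_setup R G by (simp add: group_ring_setup_def)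
  show ?thesis
  proof (rule RG.strongly_unit_nil_clean_of_strongly_pi_regular)
    fix a assume a: "a \<in> carrier RG"
    \<comment> \<open>The support of \<open>a\<close> is finite, so local finiteness makes the
      subgroup it generates finite, and \<open>a\<close> already lives over that subgroup.\<close>
    define H where "H = generate G {g. a g \<noteq> \<zero>\<^bsub>R\<^esub>}"
    have S: "{g. a g \<noteq> \<zero>\<^bsub>R\<^esub>} \<subseteq> carrier G" by (rule RG_support_subset[OF a])
    have fin: "finite H" using assms(2) RG_finite_support[OF a] S by (simp add: locally_finite_group_def H_def)
    have sub: "subgroup H G" unfolding H_def by (rule G.generate_is_subgroup[OF S])
    define G' where "G' = G\<lparr>carrier := H\<rparr>"
    have G': "group G'" unfolding G'_def by (rule G.subgroup_imp_group[OF sub])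
    interpret H: group_ring_setup R G' by (intro group_ring_setup.intro ring_axioms G')
    have G'_eq: "\<one>\<^bsub>G'\<^esub> = \<one>\<^bsub>G\<^esub>" "x \<otimes>\<^bsub>G'\<^esub> y = x \<otimes>\<^bsub>G\<^esub> y" for x y by (simp_all add: G'_def)
    \<comment> \<open>The product formula refers only to supports and to the multiplication of
      \<open>G\<close>, not to its carrier. So the operations over \<open>H\<close> and over
      \<open>G\<close> are literally the same, and witnesses found over \<open>H\<close> remain
      valid.\<close>
    have mult: "f \<otimes>\<^bsub>H.RG\<^esub> h = f \<otimes>\<^bsub>RG\<^esub> h" for f h
      by (rule ext) (simp only: RG_mult H.RG_mult G'_eq)
    have one: "\<one>\<^bsub>H.RG\<^esub> = \<one>\<^bsub>RG\<^esub>"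
      by (simp only: RG_one H.RG_one monomial_def G'_eq)
    have pow: "f [^]\<^bsub>H.RG\<^esub> n = f [^]\<^bsub>RG\<^esub> n" for f and n :: nat
      by (simp add: nat_pow_def mult one)
    have HG: "f \<in> carrier RG" if "f \<in> carrier H.RG" for f
      using that G.subgroupE(1)[OF sub] unfolding carrier_RG_iff H.carrier_RG_iff by (auto simp: G'_def)
    have "g \<in> H" if "a g \<noteq> \<zero>\<^bsub>R\<^esub>" for g using that unfolding H_def by (intro generate.incl) simp
    then have "a \<in> carrier H.RG" using a unfolding carrier_RG_iff H.carrier_RG_iff by (auto simp: G'_def)
    then have "strongly_pi_regular_elem H.RG a"
      by (intro perfect_group_ring_strongly_pi_regular[OF assms(1) G']) (simp_all add: G'_def fin)
    then show "strongly_pi_regular_elem RG a"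
      unfolding strongly_pi_regular_elem_def mult pow using HG by blast
  qed
qed

end
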